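(* Let $a,b,m,\kappa,\omega,r$ be real parameters with $am\neq 0$ and $\kappa b\neq 0$, and consider the planar system $$p'=y,\qquad y'=\frac{a\kappa\omega-r}{am}\,p-\frac{2\kappa b}{am}\,p^{3}.$$ (1) If $\kappa b(a\kappa\omega-r)>0$, the system has exactly three equilibria $P_1\left(-\sqrt{\tfrac{a\kappa\omega-r}{2\kappa b}},0\right)$, $P_2(0,0)$ and $P_3\left(\sqrt{\tfrac{a\kappa\omega-r}{2\kappa b}},0\right)$. If $\frac{\kappa b}{am}<0$, then $P_1$ and $P_3$ are saddles and $P_2$ is a center. If $\frac{\kappa b}{am}>0$, then $P_1$ and $P_3$ are centers and $P_2$ is a saddle. (2) If $\kappa b(a\kappa\omega-r)<0$, the system has only one equilibrium $P_2(0,0)$, and it is simple. If $\frac{\kappa b}{am}<0$, then $P_2$ is a saddle; if $\frac{\kappa b}{am}>0$, then $P_2$ is a center. (3) If $a\kappa\omega-r=0$, the system has a unique equilibrium $P_2(0,0)$, and it is degenerate. If $\frac{\kappa b}{am}<0$, then $P_2$ is a saddle; if $\frac{\kappa b}{am}>0$, then $P_2$ is a center.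
   Context: The prime denotes $d/d\xi$, and $(p,y)\in\mathbb{R}^2$. An equilibrium is called simple (resp. degenerate) if the Jacobian matrix of the vector field at it is invertible (resp. singular). A center is an equilibrium having a punctured neighbourhood filled with periodic orbits surrounding it. A saddle is an equilibrium near which the phase portrait is locally topologically that of a saddle: it has a neighbourhood consisting of exactly four hyperbolic sectors, separated by four separatrices, two of which tend to the equilibrium as $\xi\to+\infty$ and two as $\xi\to-\infty$. For a simple equilibrium, a saddle is equivalently one whose Jacobian has two real eigenvalues of opposite sign. *)

theory Defs
  imports "HOL-Analysis.Analysis"
begin

definition solution_on :: "(real^2 \<Rightarrow> real^2) \<Rightarrow> real set \<Rightarrow> (real \<Rightarrow> real^2) \<Rightarrow> bool" where
  "solution_on F I \<gamma> \<longleftrightarrow> (\<forall>t\<in>I. (\<gamma> has_vector_derivative F (\<gamma> t)) (at t within I))"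

definition equilibrium :: "(real^2 \<Rightarrow> real^2) \<Rightarrow> real^2 \<Rightarrow> bool" where
  "equilibrium F x \<longleftrightarrow> F x = 0"

text \<open>The differentiability conjunct makes the value of \<^const>\<open>jacobian\<close>
  meaningful, since \<^const>\<open>frechet_derivative\<close> is a choice operator.\<close>

definition simple_equilibrium :: "(real^2 \<Rightarrow> real^2) \<Rightarrow> real^2 \<Rightarrow> bool" where
  "simple_equilibrium F x \<longleftrightarrow>
     equilibrium F x \<and> F differentiable (at x) \<and> invertible (jacobian F (at x))"

definition degenerate_equilibrium :: "(real^2 \<Rightarrow> real^2) \<Rightarrow> real^2 \<Rightarrow> bool" where
  "degenerate_equilibrium F x \<longleftrightarrow>
     equilibrium F x \<and> F differentiable (at x) \<and> \<not> invertible (jacobian F (at x))"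

definition periodic_orbit :: "(real^2 \<Rightarrow> real^2) \<Rightarrow> (real^2) set \<Rightarrow> bool" where
  "periodic_orbit F C \<longleftrightarrow>
     (\<exists>\<gamma> T. T > 0 \<and> solution_on F UNIV \<gamma> \<and> (\<forall>t. \<gamma> (t + T) = \<gamma> t) \<and>
            \<not> \<gamma> constant_on UNIV \<and> C = range \<gamma>)"

text \<open>An orbit surrounds \<open>x\<close> when \<open>x\<close> lies in a bounded component of its complement.\<close>

definition is_center :: "(real^2 \<Rightarrow> real^2) \<Rightarrow> real^2 \<Rightarrow> bool" where
  "is_center F x \<longleftrightarrow> equilibrium F x \<and>
     (\<exists>U. open U \<and> x \<in> U \<and>
        (\<forall>z\<in>U - {x}. \<exists>C. periodic_orbit F C \<and> z \<in> C \<and> C \<subseteq> U - {x} \<and> x \<in> inside C))"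

text \<open>\<open>reaches F S x y\<close>: the flow leads from \<open>x\<close> to \<open>y\<close> in nonnegative time inside \<open>S\<close>.
  This relation determines the partition of \<open>S\<close> into orbit arcs and (away from closed orbits) their
  orientation, independently of the time parametrisation.  A homeomorphism preserving it
  in both directions is thus a topological equivalence of the phase portraits on two sets.\<close>

definition reaches ::
    "(real^2 \<Rightarrow> real^2) \<Rightarrow> (real^2) set \<Rightarrow> real^2 \<Rightarrow> real^2 \<Rightarrow> bool" where
  "reaches F S x y \<longleftrightarrow>
     (\<exists>\<gamma> T. T \<ge> 0 \<and> solution_on F {0..T} \<gamma> \<and> \<gamma> ` {0..T} \<subseteq> S \<and> \<gamma> 0 = x \<and> \<gamma> T = y)"

text \<open>The standard hyperbolic sector is the closed unit square with the orbits of
  \<open>u' = u, v' = - v\<close>: the arcs of the hyperbolas \<open>u v = c\<close>, which enter through the side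
  \<open>v = 1\<close> and leave through the side \<open>u = 1\<close>, together with the origin and one incoming and
  one outgoing boundary orbit on the axes.\<close>

definition model_field :: "real^2 \<Rightarrow> real^2" where
  "model_field z = vector [z $ 1, - (z $ 2)]"

definition model_sector :: "(real^2) set" where
  "model_sector = {z. 0 \<le> z $ 1 \<and> z $ 1 \<le> 1 \<and> 0 \<le> z $ 2 \<and> z $ 2 \<le> 1}"

text \<open>\<open>S\<close> is a hyperbolic sector at \<open>x\<close> with bounding separatrices \<open>\<sigma>\<close> (incoming)
  and \<open>\<upsilon>\<close> (outgoing) if it is topologically equivalent to the standard one.\<close>

definition hyperbolic_sector ::
    "(real^2 \<Rightarrow> real^2) \<Rightarrow> real^2 \<Rightarrow> (real^2) set \<Rightarrow> (real^2) set \<Rightarrow> (real^2) set \<Rightarrow> bool" where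
  "hyperbolic_sector F x S \<sigma> \<upsilon> \<longleftrightarrow> x \<in> S \<and> \<sigma> \<subseteq> S \<and> \<upsilon> \<subseteq> S \<and>
     (\<exists>h k. homeomorphism S model_sector h k \<and> h x = 0 \<and>
        h ` \<sigma> = {z \<in> model_sector. z $ 1 = 0 \<and> z $ 2 > 0} \<and>
        h ` \<upsilon> = {z \<in> model_sector. z $ 1 > 0 \<and> z $ 2 = 0} \<and>
        (\<forall>p\<in>S. \<forall>q\<in>S. reaches F S p q \<longleftrightarrow> reaches model_field model_sector (h p) (h q)))"

text \<open>Separatrices are taken as half-orbits, because solutions need not exist for all times.\<close>

definition incoming_separatrix ::
    "(real^2 \<Rightarrow> real^2) \<Rightarrow> real^2 \<Rightarrow> (real^2) set \<Rightarrow> bool" where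
  "incoming_separatrix F x \<sigma> \<longleftrightarrow> x \<notin> \<sigma> \<and>
     (\<exists>\<gamma>. solution_on F {0..} \<gamma> \<and> (\<gamma> \<longlongrightarrow> x) at_top \<and> \<sigma> = \<gamma> ` {0..})"

definition outgoing_separatrix ::
    "(real^2 \<Rightarrow> real^2) \<Rightarrow> real^2 \<Rightarrow> (real^2) set \<Rightarrow> bool" where
  "outgoing_separatrix F x \<upsilon> \<longleftrightarrow> x \<notin> \<upsilon> \<and>
     (\<exists>\<gamma>. solution_on F {..0} \<gamma> \<and> (\<gamma> \<longlongrightarrow> x) at_bot \<and> \<upsilon> = \<gamma> ` {..0})"

text \<open>The sectors \<open>S\<^sub>1, S\<^sub>2, S\<^sub>3, S\<^sub>4\<close> are listed in cyclic order; consecutive ones meet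
  exactly along a common separatrix and \<open>x\<close>, opposite ones only in \<open>x\<close>.\<close>

definition is_saddle :: "(real^2 \<Rightarrow> real^2) \<Rightarrow> real^2 \<Rightarrow> bool" where
  "is_saddle F x \<longleftrightarrow> equilibrium F x \<and>
     (\<exists>S\<^sub>1 S\<^sub>2 S\<^sub>3 S\<^sub>4 \<sigma>\<^sub>1 \<sigma>\<^sub>2 \<upsilon>\<^sub>1 \<upsilon>\<^sub>2.
        x \<in> interior (S\<^sub>1 \<union> S\<^sub>2 \<union> S\<^sub>3 \<union> S\<^sub>4) \<and>
        incoming_separatrix F x \<sigma>\<^sub>1 \<and> incoming_separatrix F x \<sigma>\<^sub>2 \<and>
        outgoing_separatrix F x \<upsilon>\<^sub>1 \<and> outgoing_separatrix F x \<upsilon>\<^sub>2 \<and>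
        hyperbolic_sector F x S\<^sub>1 \<sigma>\<^sub>1 \<upsilon>\<^sub>1 \<and> hyperbolic_sector F x S\<^sub>2 \<sigma>\<^sub>2 \<upsilon>\<^sub>1 \<and>
        hyperbolic_sector F x S\<^sub>3 \<sigma>\<^sub>2 \<upsilon>\<^sub>2 \<and> hyperbolic_sector F x S\<^sub>4 \<sigma>\<^sub>1 \<upsilon>\<^sub>2 \<and>
        S\<^sub>1 \<inter> S\<^sub>2 = insert x \<upsilon>\<^sub>1 \<and> S\<^sub>2 \<inter> S\<^sub>3 = insert x \<sigma>\<^sub>2 \<and>
        S\<^sub>3 \<inter> S\<^sub>4 = insert x \<upsilon>\<^sub>2 \<and> S\<^sub>4 \<inter> S\<^sub>1 = insert x \<sigma>\<^sub>1 \<and>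
        S\<^sub>1 \<inter> S\<^sub>3 = {x} \<and> S\<^sub>2 \<inter> S\<^sub>4 = {x})"

text \<open>The state \<open>(p, y)\<close> is the vector with components \<open>z $ 1 = p\<close> and \<open>z $ 2 = y\<close>.\<close>

definition wave_field ::
    "real \<Rightarrow> real \<Rightarrow> real \<Rightarrow> real \<Rightarrow> real \<Rightarrow> real \<Rightarrow> real^2 \<Rightarrow> real^2" where
  "wave_field a b m \<kappa> \<omega> r z =
     vector [z $ 2,
             (a * \<kappa> * \<omega> - r) / (a * m) * z $ 1 - 2 * \<kappa> * b / (a * m) * (z $ 1) ^ 3]"

end

theory Submission
  imports Defs
begin

text \<open>The system is \<open>p' = y, y' = f p\<close> with \<open>f p = \<alpha> p - \<beta> p\<^sup>3\<close> and conserves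
  \<open>y\<^sup>2/2 - \<integral>f\<close>, so every orbit is an explicit piece of a level curve run through with the speed
  dictated by a scalar equation \<open>\<theta>' = G \<theta>\<close>, which is solved by a quadrature. Around a potential
  minimum the level curves are closed and admit trigonometric parametrisations with \<open>G > 0\<close>.
  At a potential maximum \<open>p\<^sub>0\<close> write \<open>\<integral>f = s\<^sup>2/2\<close> with \<open>s\<close> continuous and strictly increasing;
  then \<open>u = y + s\<close>, \<open>v = y - s\<close> are topological coordinates with \<open>uv\<close> conserved, and they map
  each of the four sectors onto the model sector. Only the sign of \<open>(p - p\<^sub>0) f p\<close> matters,
  so the degenerate case \<open>\<alpha> = 0\<close> needs no separate treatment.\<close>

section \<open>Planar solutions from scalar flows\<close>

text \<open>A saddle is defined through \<open>reaches\<close>, so every solution inside a sector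
  has to be controlled, not only the constructed ones. No general uniqueness theorem is used for
  this. Conservation of uv and one monotone quantity place any solution on the right arc in the
  right direction, and both the given field and the model field reduce to the same time-free
  condition: some l >= 1 satisfies \<open>u w = l * u z\<close> and \<open>v z = l * v w\<close>.
  The only gap is the level uv = 0, where an arc might run into or out of the equilibrium; a
  Gronwall estimate at that single point closes it. The coordinates are merely topological because s
  need not be a diffeomorphism at the equilibrium (for \<alpha> = 0 it is quadratic on each side),
  so it is differentiated only elsewhere. For a center the neighbourhood must itself be filled by
  whole closed orbits, which is why it is cut out by an energy bound.\<close>

lemma vec2_eq_iff: "z = w \<longleftrightarrow> z $ 1 = w $ 1 \<and> z $ 2 = w $ 2" for z w :: "real^2"
  by (simp add: vec_eq_iff forall_2)

lemma vec2_tendsto: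
  fixes X Y :: "'a \<Rightarrow> real"
  assumes "(X \<longlongrightarrow> x) A" "(Y \<longlongrightarrow> y) A"
  shows "((\<lambda>t. vector [X t, Y t] :: real^2) \<longlongrightarrow> vector [x, y]) A"
proof (rule vec_tendstoI)
  fix i :: 2
  show "((\<lambda>t. (vector [X t, Y t] :: real^2) $ i) \<longlongrightarrow> (vector [x, y] :: real^2) $ i) A"
    using exhaust_2[of i] assms by auto
qed

lemma continuous_on_vec2:
  fixes X Y :: "'a::topological_space \<Rightarrow> real"
  assumes "continuous_on S X" "continuous_on S Y"
  shows "continuous_on S (\<lambda>t. vector [X t, Y t] :: real^2)"
  using assms unfolding continuous_on_def by (auto intro: vec2_tendsto)

lemma has_vector_derivative_vec2:
  fixes \<gamma> :: "real \<Rightarrow> real^2"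
  shows "(\<gamma> has_vector_derivative w) (at t within I) \<longleftrightarrow>
    ((\<lambda>t. \<gamma> t $ 1) has_real_derivative w $ 1) (at t within I) \<and>
    ((\<lambda>t. \<gamma> t $ 2) has_real_derivative w $ 2) (at t within I)"
proof -
  have *: "((\<lambda>t. \<gamma> t $ i) has_derivative (\<lambda>x. (x *\<^sub>R w) $ i)) (at t within I)
      \<longleftrightarrow> ((\<lambda>t. \<gamma> t $ i) has_real_derivative w $ i) (at t within I)" for i
    by (simp add: has_field_derivative_def mult_commute_abs)
  show ?thesis
    unfolding has_vector_derivative_def
    by (subst has_derivative_componentwise_within)
       (simp add: Basis_vec_def inner_axis forall_2 flip: *)
qed

lemma solution_on_vec2:
  "solution_on F I \<gamma> \<longleftrightarrow> (\<forall>t\<in>I.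
    ((\<lambda>t. \<gamma> t $ 1) has_real_derivative F (\<gamma> t) $ 1) (at t within I) \<and>
    ((\<lambda>t. \<gamma> t $ 2) has_real_derivative F (\<gamma> t) $ 2) (at t within I))"
  unfolding solution_on_def by (simp add: has_vector_derivative_vec2)

lemma DERIV_left_inverse:
  fixes f g :: "real \<Rightarrow> real"
  assumes "open S" "x \<in> S" "continuous_on S f" "\<And>z. z \<in> S \<Longrightarrow> g (f z) = z"
    and "DERIV f x :> D" "D \<noteq> 0"
  shows "DERIV g (f x) :> inverse D"
  unfolding has_field_derivative_def
  by (rule has_derivative_inverse_strong[OF assms(1-4) assms(5)[unfolded has_field_derivative_def]])
     (use assms(6) in \<open>auto simp: fun_eq_iff\<close>)

section \<open>Autonomous scalar equations\<close>

text \<open>The scalar equation \<open>\<theta>' = G \<theta>\<close> is solved by inverting the time function \<open>A = \<integral> 1/G\<close>;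
  the bound on \<open>G\<close> makes \<open>A\<close> surjective, so that the solution is global.\<close>

lemma scalar_flow:
  fixes G :: "real \<Rightarrow> real"
  assumes cont: "continuous_on UNIV G" and pos: "\<And>x. 0 < G x" and bd: "\<And>x. G x \<le> M"
  obtains A \<theta> where "A x0 = 0"
    "\<And>x. (A has_real_derivative 1 / G x) (at x)"
    "\<And>x. \<theta> (A x) = x" "\<And>t. A (\<theta> t) = t"
    "\<And>t. (\<theta> has_real_derivative G (\<theta> t)) (at t)"
    "strict_mono A" "strict_mono \<theta>"
proof -
  have "\<exists>F. \<forall>x::real. -\<infinity> < ereal x \<longrightarrow> ereal x < \<infinity> \<longrightarrow> (F has_vector_derivative (1 / G x)) (at x)"
    by (rule einterval_antiderivative)
       (use cont pos in \<open>auto simp: continuous_on_eq_continuous_at less_imp_neq[OF pos, symmetric]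
          intro!: continuous_intros\<close>)
  then obtain F where F: "\<And>x. (F has_real_derivative 1 / G x) (at x)"
    by (auto simp: has_real_derivative_iff_has_vector_derivative)
  define A where "A x = F x - F x0" for x
  have dA: "(A has_real_derivative 1 / G x) (at x)" for x
    unfolding A_def using F[of x] by (auto intro!: derivative_eq_intros)
  have A0: "A x0 = 0" by (simp add: A_def)
  have "A x < A y" if "x < y" for x y
    by (rule DERIV_pos_imp_increasing[OF that]) (use dA pos in \<open>meson zero_less_divide_1_iff\<close>)
  then have mono: "strict_mono A" by (simp add: strict_mono_def)
  have Mpos: "M > 0" using pos[of 0] bd[of 0] by linarith
  \<comment> \<open>As 1/G >= 1/M, the time function grows at least linearly; this gives
    surjectivity below.\<close>
  have growth: "A x + (y - x) / M \<le> A y" if "x \<le> y" for x y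
  proof -
    have "A x - x / M \<le> A y - y / M"
    proof (rule DERIV_nonneg_imp_nondecreasing[OF that])
      fix z
      have "((\<lambda>z. A z - z / M) has_real_derivative 1 / G z - 1 / M) (at z)"
        using dA[of z] Mpos by (auto intro!: derivative_eq_intros)
      moreover have "1 / G z - 1 / M \<ge> 0"
        using pos[of z] bd[of z] by (simp add: frac_le)
      ultimately show "\<exists>y. ((\<lambda>z. A z - z / M) has_real_derivative y) (at z) \<and> 0 \<le> y" by blast
    qed
    then show ?thesis by (simp add: diff_divide_distrib)
  qed
  have contA: "continuous_on T A" for T
    by (rule DERIV_continuous_on) (rule DERIV_subset[OF dA], simp)
  have surj: "\<exists>x. A x = t" for t
  proof -
    have "A (x0 - M * \<bar>t\<bar>) \<le> t"
      using growth[of "x0 - M * \<bar>t\<bar>" x0] A0 Mpos by simp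
    moreover have "t \<le> A (x0 + M * \<bar>t\<bar>)"
      using growth[of x0 "x0 + M * \<bar>t\<bar>"] A0 Mpos by simp
    moreover have "x0 - M * \<bar>t\<bar> \<le> x0 + M * \<bar>t\<bar>" using Mpos by simp
    ultimately show ?thesis
      using IVT'[of A "x0 - M * \<bar>t\<bar>" t "x0 + M * \<bar>t\<bar>"] contA by blast
  qed
  define \<theta> where "\<theta> = inv A"
  have inj: "inj A" using mono by (rule strict_mono_imp_inj_on)
  have l: "\<theta> (A x) = x" for x by (simp add: \<theta>_def inj)
  have r: "A (\<theta> t) = t" for t
    using surj[of t] unfolding \<theta>_def by (auto intro: f_inv_into_f)
  have d\<theta>: "(\<theta> has_real_derivative G (\<theta> t)) (at t)" for t
  proof -
    have "(\<theta> has_real_derivative inverse (1 / G (\<theta> t))) (at (A (\<theta> t)))"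
      by (rule DERIV_left_inverse[where S=UNIV]) (use l dA contA pos[of "\<theta> t"] in auto)
    then show ?thesis by (simp add: r)
  qed
  have "strict_mono \<theta>"
    by (metis (no_types, lifting) mono r strict_monoI strict_mono_less)
  with A0 dA l r d\<theta> mono show ?thesis by (rule that)
qed

text \<open>Clamping the argument to [a,b] extends G to a positive, continuous, bounded function on
  the line, to which the global flow applies. By monotonicity \<theta> stays in [a,b] during the
  time interval used, where the clamped equation is the original one.\<close>

lemma scalar_flow_between:
  fixes G :: "real \<Rightarrow> real"
  assumes "a \<le> b" and cont: "continuous_on {a..b} G" and pos: "\<And>x. x \<in> {a..b} \<Longrightarrow> 0 < G x"
  obtains \<theta> T where "0 \<le> T" "\<theta> 0 = a" "\<theta> T = b" "\<And>t. t \<in> {0..T} \<Longrightarrow> \<theta> t \<in> {a..b}"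
    "\<And>t. t \<in> {0..T} \<Longrightarrow> (\<theta> has_real_derivative G (\<theta> t)) (at t)"
proof -
  let ?G = "\<lambda>x. G (max a (min b x))"
  have cl: "max a (min b x) \<in> {a..b}" for x using \<open>a \<le> b\<close> by auto
  have "bdd_above (G ` {a..b})"
    by (intro bounded_imp_bdd_above compact_imp_bounded compact_continuous_image cont) simp
  then obtain M where M: "\<And>x. x \<in> {a..b} \<Longrightarrow> G x \<le> M"
    unfolding bdd_above_def by blast
  have "continuous_on UNIV ?G"
    by (rule continuous_on_compose2[OF cont]) (use cl in \<open>auto intro!: continuous_intros\<close>)
  then obtain A \<theta> where *: "A a = 0" "\<And>x. \<theta> (A x) = x" "\<And>t. A (\<theta> t) = t"
    "\<And>t. (\<theta> has_real_derivative ?G (\<theta> t)) (at t)" "strict_mono A" "strict_mono \<theta>"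
    by (rule scalar_flow[of ?G M a, OF _ pos[OF cl] M[OF cl]]) (rule that)
  have in_ab: "\<theta> t \<in> {a..b}" if "t \<in> {0..A b}" for t
    using that *(1,2) strict_mono_less_eq[OF *(6), of 0 t] strict_mono_less_eq[OF *(6), of t "A b"]
    by (metis atLeastAtMost_iff)
  show ?thesis
  proof (rule that[of "A b" \<theta>])
    show "0 \<le> A b" using *(1) \<open>a \<le> b\<close> strict_mono_less_eq[OF *(5), of a b] by simp
    show "\<theta> 0 = a" using *(1,2) by metis
    show "\<theta> t \<in> {a..b}" if "t \<in> {0..A b}" for t using in_ab[OF that] .
    show "(\<theta> has_real_derivative G (\<theta> t)) (at t)" if "t \<in> {0..A b}" for t
      using *(4)[of t] in_ab[OF that] by (simp add: max_def min_def split: if_splits)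
  qed (use * in auto)
qed

text \<open>The substitution \<open>\<theta> = exp \<phi>\<close> gives an equation on the whole line with a bounded right-hand side.\<close>

lemma scalar_flow_from_zero:
  fixes G :: "real \<Rightarrow> real"
  assumes "0 < b" and cont: "continuous_on {0<..b} G"
    and pos: "\<And>x. x \<in> {0<..b} \<Longrightarrow> 0 < G x" and bd: "\<And>x. x \<in> {0<..b} \<Longrightarrow> G x \<le> M * x"
  obtains \<theta> where "\<theta> ` {..0} = {0<..b}" "(\<theta> \<longlongrightarrow> 0) at_bot"
    "\<And>t. t \<le> 0 \<Longrightarrow> (\<theta> has_real_derivative G (\<theta> t)) (at t)"
proof -
  \<comment> \<open>Freezing the exponent at \<open>ln b\<close> continues the equation beyond the
    end point b; the solution is used only for t <= 0, where \<phi> stays below \<open>ln b\<close>.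
    The linear bound on G is exactly boundedness of G(e x)/e x, and the point 0 is moved to minus
    infinity.\<close>
  define e where "e x = exp (min (ln b) x)" for x :: real
  have e: "e x \<in> {0<..b}" for x
  proof -
    have "e x \<le> exp (ln b)" unfolding e_def by simp
    then show ?thesis using \<open>0 < b\<close> by (simp add: e_def)
  qed
  let ?G = "\<lambda>x. G (e x) / e x"
  have contG: "continuous_on UNIV ?G"
    using e by (intro continuous_intros continuous_on_compose2[OF cont])
       (auto simp: e_def intro!: continuous_intros)
  have G_bounds: "0 < ?G x" "?G x \<le> M" for x
    using pos[OF e, of x] bd[OF e, of x] e[of x] by (auto simp: field_simps)
  obtain A \<phi> where *: "A (ln b) = 0" "\<And>x. \<phi> (A x) = x" "\<And>t. A (\<phi> t) = t"
    "\<And>t. (\<phi> has_real_derivative ?G (\<phi> t)) (at t)" "strict_mono A" "strict_mono \<phi>"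
    by (rule scalar_flow[of ?G M "ln b", OF contG G_bounds]) (rule that)
  have le: "\<phi> t \<le> ln b \<longleftrightarrow> t \<le> 0" for t
    using *(1,2) strict_mono_less_eq[OF *(6), of t 0] by metis
  show ?thesis
  proof (rule that[of "\<lambda>t. exp (\<phi> t)"])
    show "(\<lambda>t. exp (\<phi> t)) ` {..0} = {0<..b}"
    proof (intro equalityI subsetI)
      fix x assume "x \<in> (\<lambda>t. exp (\<phi> t)) ` {..0}"
      then obtain t where "t \<le> 0" "x = exp (\<phi> t)" by auto
      then show "x \<in> {0<..b}" using le[of t] \<open>0 < b\<close> by (simp add: ln_ge_iff)
    next
      fix x assume "x \<in> {0<..b}"
      then have "x = exp (\<phi> (A (ln x)))" "A (ln x) \<le> 0"
        using le[of "A (ln x)"] by (auto simp: *(2))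
      then show "x \<in> (\<lambda>t. exp (\<phi> t)) ` {..0}" by blast
    qed
    have "filterlim \<phi> at_bot at_bot"
      unfolding filterlim_at_bot_le[of _ _ 0] eventually_at_bot_linorder
      using *(2,6) by (metis strict_mono_less_eq)
    then show "((\<lambda>t. exp (\<phi> t)) \<longlongrightarrow> 0) at_bot"
      by (rule filterlim_compose[OF exp_at_bot])
    fix t :: real assume "t \<le> 0"
    then have "e (\<phi> t) = exp (\<phi> t)" using le[of t] by (simp add: e_def min_def)
    then show "((\<lambda>t. exp (\<phi> t)) has_real_derivative G (exp (\<phi> t))) (at t)"
      using *(4)[of t] by (auto intro!: derivative_eq_intros)
  qed
qed

section \<open>Orbits as reparametrised curves\<close>

text \<open>In the following lemmas on curves \<open>F\<close> equals \<open>G\<close> times the velocity of the curve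
  \<open>\<tau> \<mapsto> (X \<tau>, Y \<tau>)\<close>, so the solution is the curve run with the speed \<open>\<tau>' = G \<tau>\<close>.\<close>

lemma reaches_curve:
  fixes X Y :: "real \<Rightarrow> real"
  assumes "a \<le> b" and "continuous_on {a..b} G" and "\<And>\<tau>. \<tau> \<in> {a..b} \<Longrightarrow> 0 < G \<tau>"
    and "\<And>\<tau>. \<tau> \<in> {a..b} \<Longrightarrow> (X has_real_derivative X' \<tau>) (at \<tau>)"
    and "\<And>\<tau>. \<tau> \<in> {a..b} \<Longrightarrow> (Y has_real_derivative Y' \<tau>) (at \<tau>)"
    and "\<And>\<tau>. \<tau> \<in> {a..b} \<Longrightarrow> F (vector [X \<tau>, Y \<tau>]) = vector [G \<tau> * X' \<tau>, G \<tau> * Y' \<tau>]"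
    and "\<And>\<tau>. \<tau> \<in> {a..b} \<Longrightarrow> vector [X \<tau>, Y \<tau>] \<in> S"
  shows "reaches F S (vector [X a, Y a]) (vector [X b, Y b])"
proof -
  obtain \<theta> T where \<theta>: "0 \<le> T" "\<theta> 0 = a" "\<theta> T = b" "\<And>t. t \<in> {0..T} \<Longrightarrow> \<theta> t \<in> {a..b}"
    "\<And>t. t \<in> {0..T} \<Longrightarrow> (\<theta> has_real_derivative G (\<theta> t)) (at t)"
    by (rule scalar_flow_between[OF assms(1-3)]) (assumption, rule that)
  have "((\<lambda>t. X (\<theta> t)) has_real_derivative X' (\<theta> t) * G (\<theta> t)) (at t within {0..T})"
    "((\<lambda>t. Y (\<theta> t)) has_real_derivative Y' (\<theta> t) * G (\<theta> t)) (at t within {0..T})"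
    if "t \<in> {0..T}" for t
    using DERIV_chain2[OF assms(4)[OF \<theta>(4)[OF that]] \<theta>(5)[OF that]]
      DERIV_chain2[OF assms(5)[OF \<theta>(4)[OF that]] \<theta>(5)[OF that]]
    by (simp_all add: has_field_derivative_at_within)
  then have "solution_on F {0..T} (\<lambda>t. vector [X (\<theta> t), Y (\<theta> t)])"
    unfolding solution_on_vec2 using \<theta>(4) by (auto simp: assms(6) mult.commute)
  then show ?thesis
    unfolding reaches_def using \<theta>
    by (intro exI[of _ "\<lambda>t. vector [X (\<theta> t), Y (\<theta> t)]"] exI[of _ T]) (auto intro!: assms(7))
qed

lemma periodic_orbit_curve:
  fixes X Y :: "real \<Rightarrow> real"
  assumes cont: "continuous_on UNIV G" and pos: "\<And>\<tau>. 0 < G \<tau>" and "L > 0"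
    and per: "\<And>\<tau>. G (\<tau> + L) = G \<tau>" "\<And>\<tau>. X (\<tau> + L) = X \<tau>" "\<And>\<tau>. Y (\<tau> + L) = Y \<tau>"
    and bd: "\<And>\<tau>. G \<tau> \<le> M"
    and dX: "\<And>\<tau>. (X has_real_derivative X' \<tau>) (at \<tau>)"
    and dY: "\<And>\<tau>. (Y has_real_derivative Y' \<tau>) (at \<tau>)"
    and F: "\<And>\<tau>. F (vector [X \<tau>, Y \<tau>]) = vector [G \<tau> * X' \<tau>, G \<tau> * Y' \<tau>]"
    and nc: "X s \<noteq> X t"
  shows "periodic_orbit F (range (\<lambda>\<tau>. vector [X \<tau>, Y \<tau>]))"
proof -
  obtain A \<theta> where *: "A 0 = 0" "\<And>x. (A has_real_derivative 1 / G x) (at x)"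
    "\<And>x. \<theta> (A x) = x" "\<And>t. A (\<theta> t) = t"
    "\<And>t. (\<theta> has_real_derivative G (\<theta> t)) (at t)" "strict_mono A" "strict_mono \<theta>"
    by (rule scalar_flow[OF cont pos bd, of 0]) (rule that)
  \<comment> \<open>By periodicity of G every turn of length L takes the same time, so
    \<open>A L\<close> is the period of the solution.\<close>
  have "((\<lambda>x. A (x + L) - A x) has_real_derivative 0) (at x)" for x
  proof -
    have "((\<lambda>x. A (x + L)) has_real_derivative 1 / G x) (at x)"
      using *(2)[of "x + L"] unfolding DERIV_shift by (simp add: per)
    with *(2)[of x] show ?thesis by (auto intro!: derivative_eq_intros)
  qed
  then have "A (x + L) - A x = A (0 + L) - A 0" for x
    by (intro DERIV_isconst_all) blast
  then have A_shift: "A (x + L) = A x + A L" for x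
    by (simp add: *(1) diff_eq_eq)
  have \<theta>_shift: "\<theta> (t + A L) = \<theta> t + L" for t
    using A_shift[of "\<theta> t"] *(3,4) by metis
  let ?\<gamma> = "\<lambda>t. vector [X (\<theta> t), Y (\<theta> t)] :: real^2"
  have rng: "range ?\<gamma> = range (\<lambda>\<tau>. vector [X \<tau>, Y \<tau>])"
    using *(3) by (auto simp: image_iff) metis
  have "((\<lambda>t. X (\<theta> t)) has_real_derivative X' (\<theta> t) * G (\<theta> t)) (at t)"
    "((\<lambda>t. Y (\<theta> t)) has_real_derivative Y' (\<theta> t) * G (\<theta> t)) (at t)" for t
    by (rule DERIV_chain2[OF dX *(5)]) (rule DERIV_chain2[OF dY *(5)])
  then have "solution_on F UNIV ?\<gamma>"
    unfolding solution_on_vec2 by (auto simp: F mult.commute)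
  moreover have "A L > 0" using *(1,6) \<open>L > 0\<close> by (metis strict_mono_less)
  moreover have "?\<gamma> (A s) \<noteq> ?\<gamma> (A t)" using nc by (simp add: *(3) vec2_eq_iff)
  then have "\<not> ?\<gamma> constant_on UNIV" unfolding constant_on_def by (metis UNIV_I)
  ultimately show ?thesis
    unfolding periodic_orbit_def using rng
    by (intro exI[of _ ?\<gamma>] exI[of _ "A L"]) (auto simp: \<theta>_shift per)
qed

lemma outgoing_separatrix_curve:
  fixes X Y :: "real \<Rightarrow> real"
  assumes "0 < b" and cont: "continuous_on {0<..b} G"
    and pos: "\<And>\<tau>. \<tau> \<in> {0<..b} \<Longrightarrow> 0 < G \<tau>" and bd: "\<And>\<tau>. \<tau> \<in> {0<..b} \<Longrightarrow> G \<tau> \<le> M * \<tau>"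
    and dX: "\<And>\<tau>. \<tau> \<in> {0<..b} \<Longrightarrow> (X has_real_derivative X' \<tau>) (at \<tau>)"
    and dY: "\<And>\<tau>. \<tau> \<in> {0<..b} \<Longrightarrow> (Y has_real_derivative Y' \<tau>) (at \<tau>)"
    and F: "\<And>\<tau>. \<tau> \<in> {0<..b} \<Longrightarrow> F (vector [X \<tau>, Y \<tau>]) = vector [G \<tau> * X' \<tau>, G \<tau> * Y' \<tau>]"
    and lim: "(X \<longlongrightarrow> x $ 1) (at_right 0)" "(Y \<longlongrightarrow> x $ 2) (at_right 0)"
    and eq: "\<upsilon> = (\<lambda>\<tau>. vector [X \<tau>, Y \<tau>]) ` {0<..b}" and "x \<notin> \<upsilon>"
  shows "outgoing_separatrix F x \<upsilon>"
proof -
  obtain \<theta> where \<theta>: "\<theta> ` {..0} = {0<..b}" "(\<theta> \<longlongrightarrow> 0) at_bot"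
    "\<And>t. t \<le> 0 \<Longrightarrow> (\<theta> has_real_derivative G (\<theta> t)) (at t)"
    by (rule scalar_flow_from_zero[OF assms(1-4)]) (assumption, assumption, rule that)
  have mem: "\<theta> t \<in> {0<..b}" if "t \<le> 0" for t using \<theta>(1) that by blast
  let ?\<gamma> = "\<lambda>t. vector [X (\<theta> t), Y (\<theta> t)] :: real^2"
  have "((\<lambda>t. X (\<theta> t)) has_real_derivative X' (\<theta> t) * G (\<theta> t)) (at t within {..0})"
    "((\<lambda>t. Y (\<theta> t)) has_real_derivative Y' (\<theta> t) * G (\<theta> t)) (at t within {..0})"
    if "t \<le> 0" for t
    using DERIV_chain2[OF dX[OF mem[OF that]] \<theta>(3)[OF that]]
      DERIV_chain2[OF dY[OF mem[OF that]] \<theta>(3)[OF that]]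
    by (simp_all add: has_field_derivative_at_within)
  then have "solution_on F {..0} ?\<gamma>"
    unfolding solution_on_vec2 using mem by (auto simp: F mult.commute)
  moreover have "filterlim \<theta> (at_right 0) at_bot"
    by (rule tendsto_imp_filterlim_at_right[OF \<theta>(2)])
       (use mem in \<open>auto simp: eventually_at_bot_linorder intro!: exI[of _ 0]\<close>)
  then have "(?\<gamma> \<longlongrightarrow> vector [x $ 1, x $ 2]) at_bot"
    by (intro vec2_tendsto filterlim_compose[OF lim(1)] filterlim_compose[OF lim(2)])
  moreover have "vector [x $ 1, x $ 2] = x" by (simp add: vec2_eq_iff)
  moreover have "\<upsilon> = ?\<gamma> ` {..0}"
    unfolding eq \<theta>(1)[symmetric] by (simp only: image_image)
  ultimately show ?thesis
    unfolding outgoing_separatrix_def using \<open>x \<notin> \<upsilon>\<close> by auto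
qed

text \<open>Time reversal: only half-orbits emanating from an equilibrium have to be
  constructed.\<close>

lemma incoming_separatrix_reverse:
  assumes "outgoing_separatrix (\<lambda>z. - F z) x \<upsilon>"
  shows "incoming_separatrix F x \<upsilon>"
proof -
  obtain \<gamma> where \<gamma>: "solution_on (\<lambda>z. - F z) {..0} \<gamma>" "(\<gamma> \<longlongrightarrow> x) at_bot" "\<upsilon> = \<gamma> ` {..0}" "x \<notin> \<upsilon>"
    using assms unfolding outgoing_separatrix_def by auto
  have "((\<lambda>t. \<gamma> (- t)) has_vector_derivative F (\<gamma> (- t))) (at t within {0..})" if "t \<ge> 0" for t
  proof -
    have "(\<gamma> has_vector_derivative - F (\<gamma> (- t))) (at (- t) within uminus ` {0..})"
      using \<gamma>(1) that by (simp add: solution_on_def)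
    then have "(\<gamma> \<circ> uminus has_vector_derivative (- 1) *\<^sub>R - F (\<gamma> (- t))) (at t within {0..})"
      by (intro vector_diff_chain_within) (auto intro!: derivative_eq_intros)
    then show ?thesis by (simp add: o_def)
  qed
  then have "solution_on F {0..} (\<lambda>t. \<gamma> (- t))" by (simp add: solution_on_def)
  moreover have "((\<lambda>t. \<gamma> (- t)) \<longlongrightarrow> x) at_top"
    by (rule filterlim_compose[OF \<gamma>(2) filterlim_uminus_at_bot_at_top])
  moreover have "\<upsilon> = (\<lambda>t. \<gamma> (- t)) ` {0..}"
  proof -
    have "{..0} = uminus ` {0::real..}" by simp
    then show ?thesis unfolding \<gamma>(3) by (simp only: image_image)
  qed
  ultimately show ?thesis unfolding incoming_separatrix_def using \<gamma>(4) by blast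
qed

section \<open>Newtonian systems and the hyperbolic chart at a potential maximum\<close>

definition newton_field :: "(real \<Rightarrow> real) \<Rightarrow> real^2 \<Rightarrow> real^2" where
  "newton_field f z = vector [z $ 2, f (z $ 1)]"

lemma newton_field_nth [simp]: "newton_field f z $ 1 = z $ 2" "newton_field f z $ 2 = f (z $ 1)"
  by (simp_all add: newton_field_def)

text \<open>Solutions on a compact time interval have only one-sided derivatives at its end points,
  so monotonicity is derived from the mean value theorem for derivatives within a set.\<close>

lemma nondecreasing_within:
  fixes g :: "real \<Rightarrow> real"
  assumes "a \<le> b" "{a..b} \<subseteq> S"
    and "\<And>t. t \<in> {a..b} \<Longrightarrow> (g has_real_derivative g' t) (at t within S)"
    and "\<And>t. t \<in> {a..b} \<Longrightarrow> 0 \<le> g' t"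
  shows "g a \<le> g b"
proof -
  have "\<exists>x\<in>{a..b}. g b - g a = g' x * (b - a)"
    by (rule mvt_very_simple[OF \<open>a \<le> b\<close>, where f'="\<lambda>x h. g' x * h"])
       (use assms(2,3) in \<open>auto intro: DERIV_subset simp flip: has_field_derivative_def\<close>)
  then show ?thesis using assms(1,4) by (metis diff_ge_0_iff_ge mult_nonneg_nonneg)
qed

text \<open>A zero of r propagates in both time directions: r exp(-M t) cannot increase, which
  settles times after \<open>t\<^sub>0\<close>, and r exp(M t) cannot decrease, which settles times
  before it.\<close>

lemma gronwall_zero:
  fixes r :: "real \<Rightarrow> real"
  assumes "\<And>t. t \<in> {a..b} \<Longrightarrow> (r has_real_derivative r' t) (at t within {a..b})"
    and "\<And>t. t \<in> {a..b} \<Longrightarrow> \<bar>r' t\<bar> \<le> M * r t" and "\<And>t. t \<in> {a..b} \<Longrightarrow> 0 \<le> r t"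
    and "t\<^sub>0 \<in> {a..b}" "r t\<^sub>0 = 0" "t \<in> {a..b}"
  shows "r t = 0"
proof -
  have d: "((\<lambda>t. r t * exp (m * t)) has_real_derivative (r' t + m * r t) * exp (m * t)) (at t within {a..b})"
    if "t \<in> {a..b}" for m t
    using assms(1)[OF that] by (auto intro!: derivative_eq_intros simp: algebra_simps)
  have "r t * exp (m * t) \<le> 0" if "m = (if t \<le> t\<^sub>0 then M else - M)" for m
  proof (cases "t \<le> t\<^sub>0")
    case True
    have "r t * exp (M * t) \<le> r t\<^sub>0 * exp (M * t\<^sub>0)"
    proof (rule nondecreasing_within[OF True _ d])
      fix x assume "x \<in> {t..t\<^sub>0}"
      then have "x \<in> {a..b}" using assms(4,6) by auto
      then show "x \<in> {a..b}" and "0 \<le> (r' x + M * r x) * exp (M * x)"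
        using assms(2)[of x] by (auto simp: zero_le_mult_iff)
    qed (use assms in auto)
    then show ?thesis using assms that True by simp
  next
    case False
    have "- (r t\<^sub>0 * exp (- M * t\<^sub>0)) \<le> - (r t * exp (- M * t))"
    proof (rule nondecreasing_within[OF _ _ DERIV_minus[OF d]])
      fix x assume "x \<in> {t\<^sub>0..t}"
      then have "x \<in> {a..b}" using assms(4,6) by auto
      then show "x \<in> {a..b}" and "0 \<le> - ((r' x + (- M) * r x) * exp (- M * x))"
        using assms(2)[of x] by (auto simp: mult_le_0_iff)
    qed (use assms False in auto)
    then show ?thesis using assms that False by simp
  qed
  then have "r t \<le> 0" by (metis exp_gt_zero mult_le_0_iff not_le)
  with assms(3)[OF assms(6)] show ?thesis by simp
qed

text \<open>On a branch of UV = const in the closed quadrant the difference U - V orders the points: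
  if U were larger than U', then V would exceed V' as well, and the products would differ.\<close>

lemma hyperbola_mono:
  fixes U V U' V' :: real
  assumes "0 \<le> U'" "0 \<le> V" "0 \<le> V'" "U * V = U' * V'" "U - V \<le> U' - V'"
  shows "U \<le> U'"
proof (rule ccontr)
  assume "\<not> U \<le> U'"
  then have "U' < U" "V' < V" using assms(5) by auto
  then have "U' * V' < U * V" using assms by (intro mult_strict_mono') auto
  with assms(4) show False by simp
qed

text \<open>The arc from (U, V) to (U', V') is parametrised by half the difference q of the
  coordinates; r is then half their sum, so r + q and r - q are the coordinates themselves.
  Positivity of r says that the arc avoids the corner. It could fail only for UV = 0, and there the
  factor l keeps both end points on the same half-axis, so q has a strict sign.\<close>

lemma hyperbola_arc:
  fixes U V U' V' l q :: real
  assumes nn: "0 \<le> U" "0 \<le> V" "0 \<le> U'" "0 \<le> V'" and ne: "U \<noteq> 0 \<or> V \<noteq> 0"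
    and l: "1 \<le> l" "U' = l * U" "V = l * V'"
    and q: "(U - V) / 2 \<le> q" "q \<le> (U' - V') / 2"
  defines "r \<equiv> sqrt (q\<^sup>2 + U * V)"
  shows "0 < r" "0 \<le> r + q" "r + q \<le> U'" "0 \<le> r - q" "r - q \<le> V"
proof -
  have UV: "U * V = U' * V'" using l by simp
  have rq: "(r + q) * (r - q) = U * V"
    using nn unfolding r_def by (simp add: algebra_simps power2_eq_square[symmetric])
  have "q\<^sup>2 + U * V > 0"
  proof (cases "U = 0 \<or> V = 0")
    case True
    then show ?thesis
    proof
      assume "U = 0"
      then have "q < 0" using l ne nn q by (auto simp: less_le)
      then show ?thesis using nn by (simp add: add_pos_nonneg)
    next
      assume "V = 0"
      then have "q > 0" using ne nn q by auto
      then show ?thesis using nn by (simp add: add_pos_nonneg)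
    qed
  next
    case False
    then have "U * V > 0" using nn by (simp add: less_le)
    then show ?thesis by (simp add: add_nonneg_pos)
  qed
  then show "0 < r" by (simp add: r_def)
  have "\<bar>q\<bar> \<le> r" unfolding r_def by (rule real_le_rsqrt) (use nn in simp)
  then show 1: "0 \<le> r + q" and 2: "0 \<le> r - q" by auto
  show "r + q \<le> U'"
    by (rule hyperbola_mono[where V="r - q" and V'=V']) (use rq UV nn 2 q in auto)
  show "r - q \<le> V"
    by (rule hyperbola_mono[where V="r + q" and V'=U]) (use rq nn 1 q in \<open>auto simp: mult.commute\<close>)
qed

text \<open>Here l = exp T for the travel time T. Eliminating time this way leaves an algebraic
  condition that the other field can be compared with; it also covers the axes and says that the
  corner is connected only to itself.\<close>

lemma model_reaches_iff:
  assumes "z \<in> model_sector" "w \<in> model_sector"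
  shows "reaches model_field model_sector z w \<longleftrightarrow> (\<exists>l\<ge>1. w $ 1 = l * z $ 1 \<and> z $ 2 = l * w $ 2)"
proof
  assume "reaches model_field model_sector z w"
  then obtain \<gamma> T where T: "T \<ge> 0" and sol: "solution_on model_field {0..T} \<gamma>"
    and ends: "\<gamma> 0 = z" "\<gamma> T = w" unfolding reaches_def by auto
  have d: "((\<lambda>t. \<gamma> t $ 1) has_real_derivative \<gamma> t $ 1) (at t within {0..T})"
    "((\<lambda>t. \<gamma> t $ 2) has_real_derivative - \<gamma> t $ 2) (at t within {0..T})" if "t \<in> {0..T}" for t
    using sol that by (auto simp: solution_on_vec2 model_field_def)
  have "\<exists>k. \<forall>t\<in>{0..T}. \<gamma> t $ 1 * exp (- t) = k" "\<exists>k. \<forall>t\<in>{0..T}. \<gamma> t $ 2 * exp t = k"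
    by (rule has_field_derivative_zero_constant; auto intro!: derivative_eq_intros d)+
  then have "w $ 1 * exp (- T) = z $ 1" "w $ 2 * exp T = z $ 2"
    using T ends by force+
  then have "w $ 1 = exp T * z $ 1" "z $ 2 = exp T * w $ 2"
    by (auto simp: exp_minus field_simps)
  then show "\<exists>l\<ge>1. w $ 1 = l * z $ 1 \<and> z $ 2 = l * w $ 2"
    using T by (intro exI[of _ "exp T"]) simp
next
  assume "\<exists>l\<ge>1. w $ 1 = l * z $ 1 \<and> z $ 2 = l * w $ 2"
  then obtain l where l: "l \<ge> 1" "w $ 1 = l * z $ 1" "z $ 2 = l * w $ 2" by auto
  let ?\<gamma> = "\<lambda>t. vector [z $ 1 * exp t, z $ 2 * exp (- t)] :: real^2"
  have "solution_on model_field {0..ln l} ?\<gamma>"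
    unfolding solution_on_vec2 model_field_def by (auto intro!: derivative_eq_intros)
  moreover have "?\<gamma> t \<in> model_sector" if "t \<in> {0..ln l}" for t
  proof -
    have "z $ 1 * exp t \<le> z $ 1 * l"
      using that l(1) assms by (intro mult_left_mono) (auto simp: model_sector_def ln_ge_iff)
    then have "z $ 1 * exp t \<le> w $ 1" by (simp add: l(2) mult.commute)
    moreover have "z $ 2 * exp (- t) \<le> z $ 2 * 1"
      using that assms by (intro mult_left_mono) (auto simp: model_sector_def)
    ultimately show ?thesis
      using assms unfolding model_sector_def by auto
  qed
  moreover have "?\<gamma> 0 = z" "?\<gamma> (ln l) = w"
    using l by (auto simp: vec2_eq_iff exp_minus)
  ultimately show "reaches model_field model_sector z w"
    unfolding reaches_def using l(1)
    by (intro exI[of _ ?\<gamma>] exI[of _ "ln l"]) (auto simp del: vector_2)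
qed

text \<open>-W is the potential, with a strict maximum at \<open>p\<^sub>0\<close>. The linear bound
  on f replaces a derivative there. It serves three ends: s is continuous at
  \<open>p\<^sub>0\<close>, the equilibrium is not met in finite time by other solutions, and the
  separatrices exist for an infinite time.\<close>

locale saddle_potential =
  fixes f W :: "real \<Rightarrow> real" and p\<^sub>0 \<delta> L :: real
  assumes \<delta>: "0 < \<delta>"
    and f_cont: "continuous_on {p\<^sub>0 - \<delta>..p\<^sub>0 + \<delta>} f"
    and W_zero: "W p\<^sub>0 = 0"
    and W_deriv: "\<And>x. x \<in> {p\<^sub>0 - \<delta>..p\<^sub>0 + \<delta>} \<Longrightarrow> (W has_real_derivative f x) (at x)"
    and f_sign: "\<And>x. x \<in> {p\<^sub>0 - \<delta>..p\<^sub>0 + \<delta>} \<Longrightarrow> x \<noteq> p\<^sub>0 \<Longrightarrow> 0 < (x - p\<^sub>0) * f x"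
    and f_lipschitz: "\<And>x. x \<in> {p\<^sub>0 - \<delta>..p\<^sub>0 + \<delta>} \<Longrightarrow> \<bar>f x\<bar> \<le> L * \<bar>x - p\<^sub>0\<bar>"
begin

abbreviation I where "I \<equiv> {p\<^sub>0 - \<delta>..p\<^sub>0 + \<delta>}"

text \<open>With \<open>s\<^sup>2 = 2W\<close> the first integral \<open>y\<^sup>2/2 - W\<close> becomes \<open>uv/2\<close> for
  \<open>u = y + s\<close> and \<open>v = y - s\<close>, so that \<open>(u, v)\<close> straightens the orbits to hyperbolas.\<close>

definition s :: "real \<Rightarrow> real" where
  "s x = sgn (x - p\<^sub>0) * sqrt (2 * W x)"

lemma f_p0 [simp]: "f p\<^sub>0 = 0"
  using f_lipschitz[of p\<^sub>0] \<delta> by simp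

lemma L_nonneg: "0 \<le> L"
  using f_lipschitz[of "p\<^sub>0 + \<delta>"] \<delta>
  by (smt (verit) atLeastAtMost_iff zero_le_mult_iff)

lemma W_cont: "continuous_on I W"
  by (rule DERIV_continuous_on) (rule DERIV_subset[OF W_deriv], auto)

lemma W_less_right: "W x < W y" if "p\<^sub>0 \<le> x" "x < y" "y \<le> p\<^sub>0 + \<delta>"
proof (rule DERIV_pos_imp_increasing_open[OF \<open>x < y\<close>])
  fix z assume "x < z" "z < y"
  then show "\<exists>d. (W has_real_derivative d) (at z) \<and> 0 < d"
    using W_deriv[of z] f_sign[of z] that \<delta> by (intro exI[of _ "f z"]) (auto simp: zero_less_mult_iff)
qed (rule continuous_on_subset[OF W_cont], use that \<delta> in auto)

lemma W_less_left: "W y < W x" if "p\<^sub>0 - \<delta> \<le> x" "x < y" "y \<le> p\<^sub>0"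
proof (rule DERIV_neg_imp_decreasing_open[OF \<open>x < y\<close>])
  fix z assume "x < z" "z < y"
  then show "\<exists>d. (W has_real_derivative d) (at z) \<and> d < 0"
    using W_deriv[of z] f_sign[of z] that \<delta> by (intro exI[of _ "f z"]) (auto simp: zero_less_mult_iff)
qed (rule continuous_on_subset[OF W_cont], use that \<delta> in auto)

lemma W_pos: "0 < W x" if "x \<in> I" "x \<noteq> p\<^sub>0"
  using W_less_right[of p\<^sub>0 x] W_less_left[of x p\<^sub>0] that W_zero by force

lemma W_nonneg: "x \<in> I \<Longrightarrow> 0 \<le> W x"
  using W_pos[of x] W_zero by (cases "x = p\<^sub>0") auto

lemma W_le: "W x \<le> L * (x - p\<^sub>0)\<^sup>2" if "x \<in> I"
proof -
  have "\<exists>\<xi>\<in>I. \<bar>\<xi> - p\<^sub>0\<bar> \<le> \<bar>x - p\<^sub>0\<bar> \<and> W x = (x - p\<^sub>0) * f \<xi>"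
  proof (cases x p\<^sub>0 rule: linorder_cases)
    case less
    then have "\<exists>\<xi>>x. \<xi> < p\<^sub>0 \<and> W p\<^sub>0 - W x = (p\<^sub>0 - x) * f \<xi>"
      by (rule MVT2) (rule W_deriv, use that \<delta> in auto)
    then obtain \<xi> where "x < \<xi>" "\<xi> < p\<^sub>0" "W p\<^sub>0 - W x = (p\<^sub>0 - x) * f \<xi>" by blast
    then show ?thesis using that W_zero by (intro bexI[of _ \<xi>]) (auto simp: algebra_simps)
  next
    case equal
    then show ?thesis using that W_zero by auto
  next
    case greater
    then have "\<exists>\<xi>>p\<^sub>0. \<xi> < x \<and> W x - W p\<^sub>0 = (x - p\<^sub>0) * f \<xi>"
      by (rule MVT2) (rule W_deriv, use that \<delta> in auto)
    then obtain \<xi> where "p\<^sub>0 < \<xi>" "\<xi> < x" "W x - W p\<^sub>0 = (x - p\<^sub>0) * f \<xi>" by blast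
    then show ?thesis using that W_zero by (intro bexI[of _ \<xi>]) auto
  qed
  then obtain \<xi> where \<xi>: "\<xi> \<in> I" "\<bar>\<xi> - p\<^sub>0\<bar> \<le> \<bar>x - p\<^sub>0\<bar>" "W x = (x - p\<^sub>0) * f \<xi>" by blast
  have "W x \<le> \<bar>x - p\<^sub>0\<bar> * \<bar>f \<xi>\<bar>" unfolding \<xi>(3) abs_mult[symmetric] by simp
  also have "\<dots> \<le> \<bar>x - p\<^sub>0\<bar> * (L * \<bar>x - p\<^sub>0\<bar>)"
    using f_lipschitz[OF \<xi>(1)] \<xi>(2) L_nonneg
    by (intro mult_left_mono) (auto intro: order_trans mult_left_mono)
  also have "\<dots> = L * (x - p\<^sub>0)\<^sup>2" by (simp add: power2_eq_square)
  finally show ?thesis .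
qed

section \<open>The signed root of the potential and its inverse\<close>

lemma s_p0 [simp]: "s p\<^sub>0 = 0"
  by (simp add: s_def)

lemma s_square: "(s x)\<^sup>2 = 2 * W x" if "x \<in> I"
  using W_nonneg[OF that] W_zero by (cases "x = p\<^sub>0") (auto simp: s_def power_mult_distrib sgn_if)

lemma s_pos_iff: "0 < s x \<longleftrightarrow> p\<^sub>0 < x" and s_neg_iff: "s x < 0 \<longleftrightarrow> x < p\<^sub>0" if "x \<in> I"
  using W_pos[OF that] by (cases x p\<^sub>0 rule: linorder_cases; simp add: s_def)+

lemma s_less: "s x < s y" if "x \<in> I" "y \<in> I" "x < y"
proof -
  consider "p\<^sub>0 \<le> x" | "y \<le> p\<^sub>0" | "x < p\<^sub>0" "p\<^sub>0 < y" by linarith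
  then show ?thesis
  proof cases
    case 1
    then have "(s x)\<^sup>2 < (s y)\<^sup>2" using that W_less_right[of x y] by (simp add: s_square)
    then show ?thesis using 1 that s_pos_iff[of y] by (auto intro: power2_less_imp_less)
  next
    case 2
    then have "(- s y)\<^sup>2 < (- s x)\<^sup>2" using that W_less_left[of x y] by (simp add: s_square)
    then have "- s y < - s x"
      by (rule power2_less_imp_less) (use 2 that s_neg_iff[of x] in auto)
    then show ?thesis by simp
  next
    case 3
    then show ?thesis using that s_pos_iff[of y] s_neg_iff[of x] by simp
  qed
qed

lemma s_less_iff: "s x < s y \<longleftrightarrow> x < y" and s_le_iff: "s x \<le> s y \<longleftrightarrow> x \<le> y"
  if "x \<in> I" "y \<in> I"
  using s_less that by (metis linorder_neq_iff order_less_asym, metis leD leI order_le_less)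

lemma s_eq_iff: "s x = s y \<longleftrightarrow> x = y" if "x \<in> I" "y \<in> I"
  using s_less_iff[of x y] s_less_iff[of y x] that by (metis linorder_neq_iff)

text \<open>Off \<open>p\<^sub>0\<close> the sign is locally constant, so only the root is
  differentiated; at \<open>p\<^sub>0\<close> the quotient reads 0/0.\<close>

lemma s_deriv: "(s has_real_derivative f x / s x) (at x)" if "x \<in> I" "x \<noteq> p\<^sub>0"
proof -
  have pos: "W x > 0" using W_pos that by blast
  have "((\<lambda>z. sgn (x - p\<^sub>0) * sqrt (2 * W z)) has_real_derivative f x / s x) (at x)"
    using pos that by (auto intro!: derivative_eq_intros W_deriv simp: s_def sgn_if field_simps)
  moreover have "open (if x < p\<^sub>0 then {..<p\<^sub>0} else {p\<^sub>0<..})" by simp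
  ultimately show ?thesis
    by (rule has_field_derivative_transform_within_open)
       (use that in \<open>auto simp: s_def sgn_if split: if_splits\<close>)
qed

lemma s_bound: "\<bar>s x\<bar> \<le> sqrt (2 * L) * \<bar>x - p\<^sub>0\<bar>" if "x \<in> I"
proof (rule power2_le_imp_le)
  show "\<bar>s x\<bar>\<^sup>2 \<le> (sqrt (2 * L) * \<bar>x - p\<^sub>0\<bar>)\<^sup>2"
    using W_le[OF that] L_nonneg by (simp add: s_square[OF that] power_mult_distrib)
qed (use L_nonneg in simp)

lemma s_cont: "continuous_on I s"
  unfolding continuous_on_eq_continuous_within
proof
  fix x assume "x \<in> I"
  show "continuous (at x within I) s"
  proof (cases "x = p\<^sub>0")
    case True
    have "(s \<longlongrightarrow> 0) (at p\<^sub>0 within I)"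
    proof (rule Lim_null_comparison)
      show "\<forall>\<^sub>F x in at p\<^sub>0 within I. norm (s x) \<le> sqrt (2 * L) * \<bar>x - p\<^sub>0\<bar>"
        using s_bound by (auto simp: eventually_at_filter)
      show "((\<lambda>x. sqrt (2 * L) * \<bar>x - p\<^sub>0\<bar>) \<longlongrightarrow> 0) (at p\<^sub>0 within I)"
        by (auto intro!: tendsto_eq_intros)
    qed
    then show ?thesis by (simp add: True continuous_within)
  next
    case False
    show ?thesis
      by (rule continuous_at_imp_continuous_at_within[OF DERIV_isCont[OF s_deriv[OF \<open>x \<in> I\<close> False]]])
  qed
qed

text \<open>The division by 2 keeps [-c, c] strictly inside the range of s, so that \<sigma> maps it
  into the open interval, where \<sigma> can be differentiated.\<close>

definition c :: real where
  "c = min (s (p\<^sub>0 + \<delta>)) (- s (p\<^sub>0 - \<delta>)) / 2"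

lemma c_pos: "0 < c"
  using s_pos_iff[of "p\<^sub>0 + \<delta>"] s_neg_iff[of "p\<^sub>0 - \<delta>"] \<delta> by (simp add: c_def)

definition \<sigma> :: "real \<Rightarrow> real" where
  "\<sigma> = inv_into I s"

lemma \<sigma>_s [simp]: "x \<in> I \<Longrightarrow> \<sigma> (s x) = x"
  unfolding \<sigma>_def by (intro inv_into_f_f inj_onI) (simp add: s_eq_iff)

lemma s_\<sigma>:
  assumes "\<bar>w\<bar> \<le> c"
  shows "\<sigma> w \<in> {p\<^sub>0 - \<delta><..<p\<^sub>0 + \<delta>}" "s (\<sigma> w) = w" "\<sigma> w \<in> I" "w \<in> s ` I"
proof -
  have b: "s (p\<^sub>0 - \<delta>) < w" "w < s (p\<^sub>0 + \<delta>)"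
    using assms c_pos unfolding c_def by (auto simp: min_def split: if_splits)
  then obtain x where x: "x \<in> I" "s x = w"
    using IVT'[of s "p\<^sub>0 - \<delta>" w "p\<^sub>0 + \<delta>"] s_cont \<delta> by auto
  then have "x \<noteq> p\<^sub>0 - \<delta>" "x \<noteq> p\<^sub>0 + \<delta>" using b by auto
  then show "\<sigma> w \<in> {p\<^sub>0 - \<delta><..<p\<^sub>0 + \<delta>}" "s (\<sigma> w) = w" "\<sigma> w \<in> I" "w \<in> s ` I"
    using x by auto
qed

lemma \<sigma>_cont: "continuous_on (s ` I) \<sigma>"
  by (rule continuous_on_inv[OF s_cont]) auto

lemma \<sigma>_deriv: "(\<sigma> has_real_derivative w / f (\<sigma> w)) (at w)" if "\<bar>w\<bar> \<le> c" "w \<noteq> 0"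
proof -
  note \<sigma>w = s_\<sigma>[OF that(1)]
  have ne: "\<sigma> w \<noteq> p\<^sub>0" using \<sigma>w(2) that(2) by auto
  have "(\<sigma> has_real_derivative inverse (f (\<sigma> w) / s (\<sigma> w))) (at (s (\<sigma> w)))"
  proof (rule DERIV_left_inverse[where S="{p\<^sub>0 - \<delta><..<p\<^sub>0 + \<delta>}" and f=s and x="\<sigma> w"])
    show "continuous_on {p\<^sub>0 - \<delta><..<p\<^sub>0 + \<delta>} s"
      by (rule continuous_on_subset[OF s_cont]) auto
    show "f (\<sigma> w) / s (\<sigma> w) \<noteq> 0" using f_sign[OF \<sigma>w(3) ne] \<sigma>w(2) that(2) by auto
  qed (use \<sigma>w ne s_deriv in auto)
  then show ?thesis by (simp add: \<sigma>w(2))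
qed

section \<open>Straightening coordinates and their quadrants\<close>

definition u :: "real^2 \<Rightarrow> real" where "u z = z $ 2 + s (z $ 1)"
definition v :: "real^2 \<Rightarrow> real" where "v z = z $ 2 - s (z $ 1)"

text \<open>The box is closed because sectors are compared with a closed square. The position is
  confined to \<open>I\<close> explicitly, since s is controlled only there.\<close>

definition chart_box :: "(real^2) set" where
  "chart_box = {z. z $ 1 \<in> I \<and> \<bar>u z\<bar> \<le> c \<and> \<bar>v z\<bar> \<le> c}"

text \<open>The signs \<open>e, k \<in> {1, -1}\<close> select the quadrant in the coordinates \<open>(u, v)\<close>.\<close>

definition sector :: "real \<Rightarrow> real \<Rightarrow> (real^2) set" where
  "sector e k = {z \<in> chart_box. 0 \<le> e * u z \<and> 0 \<le> k * v z}"

definition unstable_branch :: "real \<Rightarrow> (real^2) set" where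
  "unstable_branch e = {z \<in> chart_box. v z = 0 \<and> 0 < e * u z}"

definition stable_branch :: "real \<Rightarrow> (real^2) set" where
  "stable_branch k = {z \<in> chart_box. u z = 0 \<and> 0 < k * v z}"

abbreviation origin :: "real^2" where "origin \<equiv> vector [p\<^sub>0, 0]"

lemma uv_origin [simp]: "u origin = 0" "v origin = 0"
  by (simp_all add: u_def v_def)

lemma origin_in_box: "origin \<in> chart_box"
  using c_pos \<delta> by (simp add: chart_box_def)

lemma s_via_uv: "s (z $ 1) = (u z - v z) / 2" and y_via_uv: "z $ 2 = (u z + v z) / 2"
  by (simp_all add: u_def v_def)

lemma uv_product: "z $ 1 \<in> I \<Longrightarrow> u z * v z = (z $ 2)\<^sup>2 - 2 * W (z $ 1)"
  by (simp add: u_def v_def s_square[symmetric] algebra_simps power2_eq_square)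

lemma uv_inject: "z = w" if "z $ 1 \<in> I" "w $ 1 \<in> I" "u z = u w" "v z = v w"
  using that s_via_uv[of z] s_via_uv[of w] y_via_uv[of z] y_via_uv[of w] s_eq_iff[OF that(1,2)]
  by (simp add: vec2_eq_iff)

lemma uv_zero_iff: "u z = 0 \<and> v z = 0 \<longleftrightarrow> z = origin" if "z \<in> chart_box"
  using uv_inject[of z origin] that \<delta> by (auto simp: chart_box_def)

lemma continuous_on_uv:
  "continuous_on {z. z $ 1 \<in> I} u" "continuous_on {z. z $ 1 \<in> I} v"
proof -
  have "continuous_on {z::real^2. z $ 1 \<in> I} (\<lambda>z. s (z $ 1))"
    by (rule continuous_on_compose2[OF s_cont]) (auto intro!: continuous_intros)
  then show "continuous_on {z. z $ 1 \<in> I} u" "continuous_on {z. z $ 1 \<in> I} v"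
    unfolding u_def v_def by (auto intro!: continuous_intros)
qed

lemma origin_interior: "origin \<in> interior chart_box"
proof (rule interiorI)
  let ?J = "{z::real^2. z $ 1 \<in> {p\<^sub>0 - \<delta><..<p\<^sub>0 + \<delta>}}"
  let ?O = "{z \<in> ?J. (u z, v z) \<in> {-c<..<c} \<times> {-c<..<c}}"
  have "?J = (\<lambda>z::real^2. z $ 1) -` {p\<^sub>0 - \<delta><..<p\<^sub>0 + \<delta>}" by auto
  then have "open ?J"
    by (simp only:) (auto intro!: open_vimage continuous_intros)
  moreover have "continuous_on ?J (\<lambda>z. (u z, v z))"
    by (intro continuous_on_Pair continuous_on_subset[OF continuous_on_uv(1)]
        continuous_on_subset[OF continuous_on_uv(2)]) auto
  ultimately have "open (?J \<inter> (\<lambda>z. (u z, v z)) -` ({-c<..<c} \<times> {-c<..<c}))"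
    by (intro continuous_open_preimage open_Times) auto
  moreover have "?O = ?J \<inter> (\<lambda>z. (u z, v z)) -` ({-c<..<c} \<times> {-c<..<c})" by blast
  ultimately show "open ?O" by simp
  show "origin \<in> ?O" using \<delta> c_pos by simp
  show "?O \<subseteq> chart_box" by (auto simp: chart_box_def)
qed

definition chart :: "real \<Rightarrow> real \<Rightarrow> real^2 \<Rightarrow> real^2" where
  "chart e k z = vector [e * u z / c, k * v z / c]"

text \<open>Solves u = c e \<open>w $ 1\<close> and v = c k \<open>w $ 2\<close> for position and
  velocity, using s(p) = (u - v)/2 and y = (u + v)/2; the signs e and k are their own
  inverses.\<close>

definition unchart :: "real \<Rightarrow> real \<Rightarrow> real^2 \<Rightarrow> real^2" where
  "unchart e k w = vector [\<sigma> (c * (e * w $ 1 - k * w $ 2) / 2), c * (e * w $ 1 + k * w $ 2) / 2]"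

lemma scaled_difference_bound:
  fixes w :: "real^2"
  assumes "e = 1 \<or> e = - 1" "k = 1 \<or> k = - 1" "w \<in> model_sector"
  shows "\<bar>c * (e * w $ 1 - k * w $ 2) / 2\<bar> \<le> c"
proof -
  have "\<bar>e * w $ 1 - k * w $ 2\<bar> \<le> 2"
    using assms by (auto simp: model_sector_def)
  then have "c * \<bar>e * w $ 1 - k * w $ 2\<bar> \<le> c * 2"
    using c_pos by (intro mult_left_mono) auto
  then show ?thesis using c_pos by (simp add: abs_mult)
qed

lemma uv_unchart:
  assumes "e = 1 \<or> e = - 1" "k = 1 \<or> k = - 1" "w \<in> model_sector"
  shows "u (unchart e k w) = c * e * w $ 1" "v (unchart e k w) = c * k * w $ 2"
  unfolding u_def v_def unchart_def vector_2 s_\<sigma>(2)[OF scaled_difference_bound[OF assms]]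
  by (simp_all add: field_simps)

lemma unchart_in_sector:
  assumes "e = 1 \<or> e = - 1" "k = 1 \<or> k = - 1" "w \<in> model_sector"
  shows "unchart e k w \<in> sector e k"
  using uv_unchart[OF assms] s_\<sigma>(3)[OF scaled_difference_bound[OF assms]] assms c_pos
  by (auto simp: sector_def chart_box_def model_sector_def unchart_def abs_mult mult_le_cancel_left1)

lemma chart_in_model:
  assumes "e = 1 \<or> e = - 1" "k = 1 \<or> k = - 1" "z \<in> sector e k"
  shows "chart e k z \<in> model_sector"
  using assms c_pos by (auto simp: sector_def chart_box_def model_sector_def chart_def)

lemma sector_homeomorphism:
  assumes e: "e = 1 \<or> e = - 1" and k: "k = 1 \<or> k = - 1"
  shows "homeomorphism (sector e k) model_sector (chart e k) (unchart e k)"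
proof (rule homeomorphismI)
  have "sector e k \<subseteq> {z. z $ 1 \<in> I}" by (auto simp: sector_def chart_box_def)
  then show "continuous_on (sector e k) (chart e k)"
    unfolding chart_def using c_pos
    by (intro continuous_on_vec2 continuous_intros continuous_on_subset[OF continuous_on_uv(1)]
        continuous_on_subset[OF continuous_on_uv(2)]) auto
  show "continuous_on model_sector (unchart e k)"
    unfolding unchart_def
    by (intro continuous_on_vec2 continuous_on_compose2[OF \<sigma>_cont])
       (auto intro!: continuous_intros intro: s_\<sigma>(4) scaled_difference_bound[OF e k])
  show "unchart e k (chart e k z) = z" if "z \<in> sector e k" for z
  proof (rule uv_inject)
    show "unchart e k (chart e k z) $ 1 \<in> I" "z $ 1 \<in> I"
      using unchart_in_sector[OF e k chart_in_model[OF e k that]] that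
      by (auto simp: sector_def chart_box_def)
    show "u (unchart e k (chart e k z)) = u z" "v (unchart e k (chart e k z)) = v z"
      unfolding uv_unchart[OF e k chart_in_model[OF e k that]]
      using e k c_pos by (auto simp: chart_def)
  qed
  show "chart e k (unchart e k w) = w" if "w \<in> model_sector" for w
    using e k c_pos by (auto simp: vec2_eq_iff chart_def uv_unchart[OF e k that])
qed (use chart_in_model[OF e k] unchart_in_sector[OF e k] in auto)

text \<open>The squared distance to the equilibrium satisfies |r'| <= (1 + L) r, so
  \<open>gronwall_zero\<close> applies forwards and backwards in time. This is needed because the
  equilibrium has the same value of uv as the separatrices.\<close>

lemma equilibrium_not_reached:
  assumes sol: "solution_on (newton_field f) {0..T} \<gamma>" and in_box: "\<gamma> ` {0..T} \<subseteq> chart_box"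
    and "t\<^sub>0 \<in> {0..T}" "\<gamma> t\<^sub>0 = origin" "t \<in> {0..T}"
  shows "\<gamma> t = origin"
proof -
  let ?r = "\<lambda>t. (\<gamma> t $ 1 - p\<^sub>0)\<^sup>2 + (\<gamma> t $ 2)\<^sup>2"
  let ?r' = "\<lambda>t. 2 * ((\<gamma> t $ 1 - p\<^sub>0) * \<gamma> t $ 2 + \<gamma> t $ 2 * f (\<gamma> t $ 1))"
  have "?r t = 0"
  proof (rule gronwall_zero[where r'="?r'" and M="1 + L" and r="?r" and t=t and a=0 and b=T and t\<^sub>0=t\<^sub>0])
    fix t assume t: "t \<in> {0..T}"
    show "(?r has_real_derivative ?r' t) (at t within {0..T})"
      using sol t unfolding solution_on_vec2
      by (auto intro!: derivative_eq_intros simp: algebra_simps)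
    have lip: "\<bar>f (\<gamma> t $ 1)\<bar> \<le> L * \<bar>\<gamma> t $ 1 - p\<^sub>0\<bar>"
      using in_box t by (intro f_lipschitz) (auto simp: chart_box_def image_subset_iff)
    let ?a = "\<bar>\<gamma> t $ 1 - p\<^sub>0\<bar>" and ?b = "\<bar>\<gamma> t $ 2\<bar>"
    have "\<bar>?r' t\<bar> \<le> 2 * (?a * ?b + ?b * \<bar>f (\<gamma> t $ 1)\<bar>)"
      by (simp add: abs_mult[symmetric] abs_triangle_ineq)
    also have "\<dots> \<le> 2 * (?a * ?b + ?b * (L * ?a))"
      using lip by (intro mult_left_mono add_left_mono) auto
    also have "\<dots> = (1 + L) * (2 * ?a * ?b)" by (simp add: algebra_simps)
    also have "\<dots> \<le> (1 + L) * (?a\<^sup>2 + ?b\<^sup>2)"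
      using L_nonneg by (intro mult_left_mono sum_squares_bound) auto
    finally show "\<bar>?r' t\<bar> \<le> (1 + L) * ?r t" by simp
  qed (use assms in auto)
  then show ?thesis by (simp add: vec2_eq_iff sum_power2_eq_zero_iff)
qed

lemma uv_product_const:
  assumes sol: "solution_on (newton_field f) {0..T} \<gamma>" and in_box: "\<gamma> ` {0..T} \<subseteq> chart_box"
    and t: "t \<in> {0..T}"
  shows "u (\<gamma> t) * v (\<gamma> t) = u (\<gamma> 0) * v (\<gamma> 0)"
proof -
  \<comment> \<open>The product uv is rewritten as the energy expression, which is differentiable
    also where the position is \<open>p\<^sub>0\<close>.\<close>
  let ?H = "\<lambda>t. (\<gamma> t $ 2)\<^sup>2 - 2 * W (\<gamma> t $ 1)"
  have I: "\<gamma> t $ 1 \<in> I" if "t \<in> {0..T}" for t using in_box that by (auto simp: chart_box_def image_subset_iff)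
  have "(?H has_real_derivative 0) (at t within {0..T})" if "t \<in> {0..T}" for t
    using sol that unfolding solution_on_vec2
    by (auto intro!: derivative_eq_intros DERIV_chain2[where f=W and g="\<lambda>t. \<gamma> t $ 1", OF W_deriv[OF I]])
  then have "\<exists>k. \<forall>t\<in>{0..T}. ?H t = k"
    by (intro has_field_derivative_zero_constant) auto
  then obtain k where "\<And>t. t \<in> {0..T} \<Longrightarrow> ?H t = k" by blast
  moreover have "0 \<in> {0..T}" using t by simp
  ultimately have "?H t = ?H 0" using t by metis
  moreover have "\<gamma> 0 $ 1 \<in> I" by (rule I) fact
  ultimately show ?thesis using uv_product[OF I[OF t]] uv_product[of "\<gamma> 0"] by simp
qed

text \<open>Up to the factor 2 the quantity is e s(p) if k = e and e y if k = -e. In the first kind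
  of sector the velocity has sign e; in the second the position lies on the side e of
  \<open>p\<^sub>0\<close>, so the force has sign e.\<close>

lemma solution_monotone:
  assumes e: "e = 1 \<or> e = - 1" and k: "k = 1 \<or> k = - 1" and "0 \<le> T"
    and sol: "solution_on (newton_field f) {0..T} \<gamma>" and in_S: "\<gamma> ` {0..T} \<subseteq> sector e k"
  shows "e * u (\<gamma> 0) - k * v (\<gamma> 0) \<le> e * u (\<gamma> T) - k * v (\<gamma> T)"
proof -
  have S: "\<gamma> t \<in> sector e k" and I: "\<gamma> t $ 1 \<in> I" if "t \<in> {0..T}" for t
    using in_S that by (auto simp: sector_def chart_box_def image_subset_iff)
  have d: "((\<lambda>t. e * \<gamma> t $ 1) has_real_derivative e * \<gamma> t $ 2) (at t within {0..T})"
    "((\<lambda>t. e * \<gamma> t $ 2) has_real_derivative e * f (\<gamma> t $ 1)) (at t within {0..T})"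
    if "t \<in> {0..T}" for t
    using sol that unfolding solution_on_vec2 by (auto intro!: derivative_eq_intros)
  consider "k = e" | "k = - e" using e k by auto
  then show ?thesis
  proof cases
    case 1
    have "e * \<gamma> 0 $ 1 \<le> e * \<gamma> T $ 1"
    proof (rule nondecreasing_within[OF \<open>0 \<le> T\<close> _ d(1)])
      show "0 \<le> e * \<gamma> t $ 2" if "t \<in> {0..T}" for t
        using S[OF that] 1 by (simp add: sector_def y_via_uv ring_distribs)
    qed auto
    then have "e * s (\<gamma> 0 $ 1) \<le> e * s (\<gamma> T $ 1)"
      using e I[of 0] I[of T] \<open>0 \<le> T\<close> by (auto simp: s_le_iff)
    then show ?thesis by (simp add: 1 s_via_uv right_diff_distrib)
  next
    case 2
    have "e * \<gamma> 0 $ 2 \<le> e * \<gamma> T $ 2"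
    proof (rule nondecreasing_within[OF \<open>0 \<le> T\<close> _ d(2)])
      fix t assume t: "t \<in> {0..T}"
      have "0 \<le> e * s (\<gamma> t $ 1)"
        using S[OF t] 2 by (simp add: sector_def s_via_uv ring_distribs)
      then have "0 \<le> e * (\<gamma> t $ 1 - p\<^sub>0)"
        using e s_pos_iff[OF I[OF t]] s_neg_iff[OF I[OF t]] by (auto simp: not_less[symmetric])
      then show "0 \<le> e * f (\<gamma> t $ 1)"
        using e f_sign[OF I[OF t]] by (cases "\<gamma> t $ 1 = p\<^sub>0") (auto simp: zero_less_mult_iff)
    qed auto
    then show ?thesis by (simp add: 2 y_via_uv ring_distribs)
  qed
qed

text \<open>A constant product and a nondecreasing difference force U up and V down, by
  \<open>hyperbola_mono\<close>; the factor l is the ratio of U or of V, whichever is nonzero at the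
  start.\<close>

lemma sector_reaches_imp:
  assumes e: "e = 1 \<or> e = - 1" and k: "k = 1 \<or> k = - 1"
    and reach: "reaches (newton_field f) (sector e k) z w"
  shows "\<exists>l\<ge>1. u w = l * u z \<and> v z = l * v w"
proof -
  obtain \<gamma> T where T: "T \<ge> 0" and sol: "solution_on (newton_field f) {0..T} \<gamma>"
    and in_S: "\<gamma> ` {0..T} \<subseteq> sector e k" and ends: "\<gamma> 0 = z" "\<gamma> T = w"
    using reach unfolding reaches_def by auto
  have in_box: "\<gamma> ` {0..T} \<subseteq> chart_box" using in_S by (auto simp: sector_def)
  define U where "U t = e * u (\<gamma> t)" for t
  define V where "V t = k * v (\<gamma> t)" for t
  have nn: "0 \<le> U t" "0 \<le> V t" if "t \<in> {0..T}" for t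
    using in_S that by (auto simp: U_def V_def sector_def image_subset_iff)
  have prod: "U t * V t = U 0 * V 0" if "t \<in> {0..T}" for t
    using uv_product_const[OF sol in_box that]
    by (simp add: U_def V_def algebra_simps)
  have mono: "U 0 - V 0 \<le> U T - V T"
    unfolding U_def V_def by (rule solution_monotone[OF e k T sol in_S])
  have zero: "\<gamma> t = origin \<longleftrightarrow> U t = 0 \<and> V t = 0" if "t \<in> {0..T}" for t
    using uv_zero_iff[of "\<gamma> t"] in_box that e k by (auto simp: U_def V_def image_subset_iff)
  have persist: "U t' = 0 \<and> V t' = 0" if "U t = 0" "V t = 0" "t \<in> {0..T}" "t' \<in> {0..T}" for t t'
    using equilibrium_not_reached[OF sol in_box that(3) _ that(4)] zero that by blast
  have ends_mem: "0 \<in> {0..T}" "T \<in> {0..T}" using T by auto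
  have cont: "continuous_on {0..T} (\<lambda>t. U t - V t)"
  proof -
    have "continuous_on {0..T} \<gamma>"
      using sol unfolding solution_on_def continuous_on_eq_continuous_within
      by (blast intro: has_vector_derivative_continuous)
    then have "continuous_on {0..T} (\<lambda>t. u (\<gamma> t))" "continuous_on {0..T} (\<lambda>t. v (\<gamma> t))"
      by (intro continuous_on_compose2[OF continuous_on_uv(1)]
          continuous_on_compose2[OF continuous_on_uv(2)]; use in_box in \<open>auto simp: chart_box_def\<close>)+
    then show ?thesis unfolding U_def V_def by (intro continuous_intros)
  qed
  have "\<exists>l\<ge>1. U T = l * U 0 \<and> V 0 = l * V T"
  proof -
    have UT: "U 0 \<le> U T" and VT: "V T \<le> V 0"
      using hyperbola_mono[of "U T" "V 0" "V T" "U 0"] hyperbola_mono[of "V 0" "U T" "U 0" "V T"]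
        nn[OF ends_mem(1)] nn[OF ends_mem(2)] prod[OF ends_mem(2)] mono
      by (simp_all add: mult.commute)
    consider "U 0 = 0" "V 0 = 0" | "U 0 > 0" | "U 0 = 0" "V 0 > 0"
      using nn[OF ends_mem(1)] by fastforce
    then show ?thesis
    proof cases
      case 1
      then show ?thesis using persist[OF 1 ends_mem] by (intro exI[of _ 1]) auto
    next
      case 2
      have "V 0 = (U T / U 0) * V T" using prod[OF ends_mem(2)] 2 by (simp add: field_simps)
      then show ?thesis using 2 UT by (intro exI[of _ "U T / U 0"]) auto
    next
      case 3
      \<comment> \<open>A solution starting on the incoming axis cannot get off it: otherwise U - V
        changes sign, and at its zero the vanishing product puts the solution at the equilibrium,
        where it would have been all along.\<close>
      have "V T \<noteq> 0"
      proof
        assume "V T = 0"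
        then have "U 0 - V 0 \<le> 0" "0 \<le> U T - V T" using 3 nn[OF ends_mem(2)] by auto
        then obtain t where t: "t \<in> {0..T}" "U t - V t = 0"
          using IVT'[of "\<lambda>t. U t - V t" 0 0 T] cont T by auto
        then have "U t = 0" "V t = 0" using prod[OF t(1)] 3(1) by auto
        then show False using persist[OF _ _ t(1) ends_mem(1)] 3 by auto
      qed
      moreover from this have "U T = 0" using prod[OF ends_mem(2)] 3 by simp
      ultimately show ?thesis using 3 VT nn[OF ends_mem(2)]
        by (intro exI[of _ "V 0 / V T"]) (auto simp: field_simps)
    qed
  qed
  then show ?thesis
    using e k unfolding U_def V_def ends by auto
qed

text \<open>Orbits in the sectors with \<open>e = k\<close> are graphs over the position axis, those with
  \<open>e = -k\<close> (which turn around) are graphs over the velocity axis.\<close>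

lemma sector_reaches:
  assumes e: "e = 1 \<or> e = - 1" and k: "k = 1 \<or> k = - 1"
    and z: "z \<in> sector e k" and w: "w \<in> sector e k"
    and l: "1 \<le> l" "u w = l * u z" "v z = l * v w"
  shows "reaches (newton_field f) (sector e k) z w"
proof (cases "z = origin")
  case True
  then have "u w = 0" "v w = 0" using l by auto
  then have "w = origin" using uv_zero_iff[of w] w by (auto simp: sector_def)
  moreover have "newton_field f origin = 0" by (simp add: vec2_eq_iff)
  then have "solution_on (newton_field f) {0..0} (\<lambda>_. origin)" by (simp add: solution_on_def)
  ultimately show ?thesis
    using True z unfolding reaches_def by (intro exI[of _ "\<lambda>_. origin"] exI[of _ 0]) simp
next
  case False
  define U V U' V' where "U = e * u z" and "V = k * v z" and "U' = e * u w" and "V' = k * v w"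
  note defs = this
  have nn: "0 \<le> U" "0 \<le> V" "0 \<le> U'" "0 \<le> V'"
    using z w by (auto simp: defs sector_def)
  have ne: "U \<noteq> 0 \<or> V \<noteq> 0"
    using False uv_zero_iff[of z] z e k by (auto simp: defs sector_def)
  have l': "U' = l * U" "V = l * V'" using l by (auto simp: defs)
  have le_c: "U' \<le> c" "V \<le> c" using z w e k by (auto simp: defs sector_def chart_box_def)
  have Iz: "z $ 1 \<in> I" "w $ 1 \<in> I" using z w by (auto simp: sector_def chart_box_def)
  have ee: "e * e = 1" "e\<^sup>2 = 1" "\<And>a. e * (e * a) = a" using e by auto
  define r where "r q = sqrt (q\<^sup>2 + U * V)" for q
  note arc = hyperbola_arc[OF nn ne l(1) l', folded r_def]
  have r_ends: "r ((U - V) / 2) = (U + V) / 2" "r ((U' - V') / 2) = (U' + V') / 2"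
  proof -
    have "((U - V) / 2)\<^sup>2 + U * V = ((U + V) / 2)\<^sup>2" by (simp add: power2_eq_square field_simps)
    moreover have "((U' - V') / 2)\<^sup>2 + U * V = ((U' + V') / 2)\<^sup>2"
      using l' by (simp add: power2_eq_square field_simps)
    ultimately show "r ((U - V) / 2) = (U + V) / 2" "r ((U' - V') / 2) = (U' + V') / 2"
      unfolding r_def using nn by simp_all
  qed
  have UV_le: "U - V \<le> U' - V'"
  proof -
    have "U \<le> U'" "V' \<le> V" using l l' nn by (auto simp: mult_le_cancel_right1)
    then show ?thesis by simp
  qed
  consider "k = e" | "k = - e" using e k by auto
  then show ?thesis
  proof cases
    case 1
    \<comment> \<open>The parameter is \<tau> = e p. It is turned into the arc parameter q of
      \<open>hyperbola_arc\<close>; the speed G is then |y|, read off from the conserved energy as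
      \<open>sqrt (2 * W p + U * V)\<close>.\<close>
    define q where "q \<tau> = e * s (e * \<tau>)" for \<tau>
    have ez: "e * s (z $ 1) = (U - V) / 2" "e * z $ 2 = (U + V) / 2"
      "e * s (w $ 1) = (U' - V') / 2" "e * w $ 2 = (U' + V') / 2"
      by (simp_all add: 1 defs s_via_uv y_via_uv algebra_simps)
    have "e * s (z $ 1) \<le> e * s (w $ 1)" using UV_le by (simp add: ez)
    then have ab: "e * z $ 1 \<le> e * w $ 1" using e Iz by (auto simp: s_le_iff)
    have mem: "e * \<tau> \<in> I" "(U - V) / 2 \<le> q \<tau>" "q \<tau> \<le> (U' - V') / 2"
      if "\<tau> \<in> {e * z $ 1..e * w $ 1}" for \<tau>
    proof -
      show I: "e * \<tau> \<in> I" using that e Iz by auto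
      show "(U - V) / 2 \<le> q \<tau>" "q \<tau> \<le> (U' - V') / 2"
        unfolding ez(1,3)[symmetric] q_def using that e Iz I by (auto simp: s_le_iff)
    qed
    have q2: "(q \<tau>)\<^sup>2 = 2 * W (e * \<tau>)" if "\<tau> \<in> {e * z $ 1..e * w $ 1}" for \<tau>
      using s_square[OF mem(1)[OF that]] by (simp add: q_def power_mult_distrib ee)
    let ?Y = "\<lambda>\<tau>. e * sqrt (2 * W (e * \<tau>) + U * V)"
    have Y: "?Y \<tau> = e * r (q \<tau>)" if "\<tau> \<in> {e * z $ 1..e * w $ 1}" for \<tau>
      using q2[OF that] by (simp add: r_def)
    have "reaches (newton_field f) (sector e k)
        (vector [e * (e * z $ 1), ?Y (e * z $ 1)]) (vector [e * (e * w $ 1), ?Y (e * w $ 1)])"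
    proof (rule reaches_curve[OF ab, where G="\<lambda>\<tau>. sqrt (2 * W (e * \<tau>) + U * V)"
          and X'="\<lambda>_. e" and Y'="\<lambda>\<tau>. f (e * \<tau>) / sqrt (2 * W (e * \<tau>) + U * V)"])
      show "continuous_on {e * z $ 1..e * w $ 1} (\<lambda>\<tau>. sqrt (2 * W (e * \<tau>) + U * V))"
        using mem(1) by (intro continuous_intros continuous_on_compose2[OF W_cont]) auto
      fix \<tau> assume \<tau>: "\<tau> \<in> {e * z $ 1..e * w $ 1}"
      have r: "sqrt (2 * W (e * \<tau>) + U * V) = r (q \<tau>)" using q2[OF \<tau>] by (simp add: r_def)
      note arc\<tau> = arc[OF mem(2,3)[OF \<tau>]]
      show pos: "0 < sqrt (2 * W (e * \<tau>) + U * V)" unfolding r by (rule arc\<tau>(1))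
      show "((*) e has_real_derivative e) (at \<tau>)" by (auto intro!: derivative_eq_intros)
      have "((\<lambda>\<tau>. W (e * \<tau>)) has_real_derivative f (e * \<tau>) * e) (at \<tau>)"
        by (rule DERIV_chain2[where f=W and g="(*) e", OF W_deriv[OF mem(1)[OF \<tau>]]]) (auto intro!: derivative_eq_intros)
      then show "(?Y has_real_derivative f (e * \<tau>) / sqrt (2 * W (e * \<tau>) + U * V)) (at \<tau>)"
        using pos by (auto intro!: derivative_eq_intros simp: field_simps ee)
      show "newton_field f (vector [e * \<tau>, ?Y \<tau>]) = vector [sqrt (2 * W (e * \<tau>) + U * V) * e,
          sqrt (2 * W (e * \<tau>) + U * V) * (f (e * \<tau>) / sqrt (2 * W (e * \<tau>) + U * V))]"
        using pos by (simp add: newton_field_def mult.commute)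
      have se: "s (e * \<tau>) = e * q \<tau>" by (simp add: q_def ee)
      have "u (vector [e * \<tau>, ?Y \<tau>]) = e * (r (q \<tau>) + q \<tau>)"
        "v (vector [e * \<tau>, ?Y \<tau>]) = e * (r (q \<tau>) - q \<tau>)"
        by (simp_all add: u_def v_def r se ring_distribs)
      then show "vector [e * \<tau>, ?Y \<tau>] \<in> sector e k"
        using mem(1)[OF \<tau>] arc\<tau> le_c e by (auto simp: sector_def chart_box_def 1)
    qed
    moreover have "?Y (e * z $ 1) = z $ 2" "?Y (e * w $ 1) = w $ 2"
    proof -
      have "q (e * z $ 1) = (U - V) / 2" "q (e * w $ 1) = (U' - V') / 2"
        by (simp_all only: q_def ee ez)
      then show "?Y (e * z $ 1) = z $ 2" "?Y (e * w $ 1) = w $ 2"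
        using Y[of "e * z $ 1"] Y[of "e * w $ 1"] ab r_ends ez(2,4) ee(3) by (metis atLeastAtMost_iff order_refl)+
    qed
    moreover have "vector [z $ 1, z $ 2] = z" "vector [w $ 1, w $ 2] = w" by (simp_all add: vec2_eq_iff)
    ultimately show ?thesis by (simp add: ee)
  next
    case 2
    have ez: "e * s (z $ 1) = (U + V) / 2" "e * z $ 2 = (U - V) / 2"
      "e * s (w $ 1) = (U' + V') / 2" "e * w $ 2 = (U' - V') / 2"
      by (simp_all add: 2 defs s_via_uv y_via_uv algebra_simps)
    have ab: "e * z $ 2 \<le> e * w $ 2" using UV_le by (simp add: ez)
    \<comment> \<open>Now \<tau> = e y is itself the arc parameter, and the position is recovered
      from s(p) = e r. The speed is |f|, positive because r > 0 keeps the orbit away from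
      \<open>p\<^sub>0\<close>.\<close>
    let ?X = "\<lambda>\<tau>. \<sigma> (e * r \<tau>)"
    have arc\<tau>: "0 < r \<tau>" "0 \<le> r \<tau> + \<tau>" "r \<tau> + \<tau> \<le> c" "0 \<le> r \<tau> - \<tau>" "r \<tau> - \<tau> \<le> c"
      if "\<tau> \<in> {e * z $ 2..e * w $ 2}" for \<tau>
      using arc[of \<tau>] that le_c unfolding ez by auto
    have rc: "\<bar>e * r \<tau>\<bar> \<le> c" if "\<tau> \<in> {e * z $ 2..e * w $ 2}" for \<tau>
      using arc\<tau>[OF that] e by auto
    have X: "?X \<tau> \<in> I" "s (?X \<tau>) = e * r \<tau>" "?X \<tau> \<noteq> p\<^sub>0" "0 < e * f (?X \<tau>)"
      if "\<tau> \<in> {e * z $ 2..e * w $ 2}" for \<tau>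
    proof -
      show I: "?X \<tau> \<in> I" and sX: "s (?X \<tau>) = e * r \<tau>" using s_\<sigma>[OF rc[OF that]] by auto
      then show ne: "?X \<tau> \<noteq> p\<^sub>0" using arc\<tau>(1)[OF that] e by auto
      show "0 < e * f (?X \<tau>)"
        using f_sign[OF I ne] s_pos_iff[OF I] s_neg_iff[OF I] arc\<tau>(1)[OF that] e sX
        by (auto simp: zero_less_mult_iff)
    qed
    have contr: "continuous_on T r" for T unfolding r_def by (intro continuous_intros)
    have "reaches (newton_field f) (sector e k)
        (vector [?X (e * z $ 2), e * (e * z $ 2)]) (vector [?X (e * w $ 2), e * (e * w $ 2)])"
    proof (rule reaches_curve[OF ab, where G="\<lambda>\<tau>. e * f (?X \<tau>)"
          and X'="\<lambda>\<tau>. \<tau> / f (?X \<tau>)" and Y'="\<lambda>_. e"])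
      show "continuous_on {e * z $ 2..e * w $ 2} (\<lambda>\<tau>. e * f (?X \<tau>))"
        using X(1) s_\<sigma>(4)[OF rc]
        by (intro continuous_intros continuous_on_compose2[OF f_cont] continuous_on_compose2[OF \<sigma>_cont] contr)
           auto
      fix \<tau> assume \<tau>: "\<tau> \<in> {e * z $ 2..e * w $ 2}"
      show "0 < e * f (?X \<tau>)" using X(4)[OF \<tau>] .
      show "((*) e has_real_derivative e) (at \<tau>)" by (auto intro!: derivative_eq_intros)
      have r0: "0 < \<tau>\<^sup>2 + U * V" using arc\<tau>(1)[OF \<tau>] by (simp add: r_def)
      have "(r has_real_derivative \<tau> / r \<tau>) (at \<tau>)"
        unfolding r_def using r0 by (auto intro!: derivative_eq_intros simp: field_simps)
      then have dr: "((\<lambda>\<tau>. e * r \<tau>) has_real_derivative e * (\<tau> / r \<tau>)) (at \<tau>)"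
        by (rule DERIV_cmult)
      have "e * r \<tau> \<noteq> 0" using arc\<tau>(1)[OF \<tau>] e by auto
      then have "(?X has_real_derivative (e * r \<tau> / f (?X \<tau>)) * (e * (\<tau> / r \<tau>))) (at \<tau>)"
        by (intro DERIV_chain2[where f=\<sigma> and g="\<lambda>\<tau>. e * r \<tau>", OF \<sigma>_deriv dr] rc \<tau>)
      moreover have "(e * r \<tau> / f (?X \<tau>)) * (e * (\<tau> / r \<tau>)) = (e * e) * (\<tau> / f (?X \<tau>))"
        using arc\<tau>(1)[OF \<tau>] by simp
      ultimately show "(?X has_real_derivative \<tau> / f (?X \<tau>)) (at \<tau>)" by (simp only: ee mult_1)
      show "newton_field f (vector [?X \<tau>, e * \<tau>])
          = vector [e * f (?X \<tau>) * (\<tau> / f (?X \<tau>)), e * f (?X \<tau>) * e]"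
        using X(4)[OF \<tau>] e by (auto simp: newton_field_def)
      have "u (vector [?X \<tau>, e * \<tau>]) = e * (r \<tau> + \<tau>)" "v (vector [?X \<tau>, e * \<tau>]) = - e * (r \<tau> - \<tau>)"
        by (simp_all add: u_def v_def X(2)[OF \<tau>] algebra_simps)
      then show "vector [?X \<tau>, e * \<tau>] \<in> sector e k"
        using X(1)[OF \<tau>] arc\<tau>[OF \<tau>] e by (auto simp: sector_def chart_box_def 2)
    qed
    moreover have "?X (e * z $ 2) = z $ 1" "?X (e * w $ 2) = w $ 1"
      using r_ends Iz by (simp_all add: ez(2,4) flip: ez(1,3)) (simp_all add: ee)
    moreover have "vector [z $ 1, z $ 2] = z" "vector [w $ 1, w $ 2] = w" by (simp_all add: vec2_eq_iff)
    ultimately show ?thesis by (simp add: ee)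
  qed
qed

text \<open>Signs and the scale c cancel from the condition on l, so it is literally the same for
  the sector and for its image in the model.\<close>

lemma sector_hyperbolic:
  assumes e: "e = 1 \<or> e = - 1" and k: "k = 1 \<or> k = - 1"
  shows "hyperbolic_sector (newton_field f) origin (sector e k) (stable_branch k) (unstable_branch e)"
proof -
  note hom = sector_homeomorphism[OF e k]
  have sub: "stable_branch k \<subseteq> sector e k" "unstable_branch e \<subseteq> sector e k"
    by (auto simp: sector_def stable_branch_def unstable_branch_def)
  have preimage: "chart e k ` B = {w \<in> model_sector. P w}"
    if "B \<subseteq> sector e k" "\<And>z. z \<in> sector e k \<Longrightarrow> z \<in> B \<longleftrightarrow> P (chart e k z)" for B P
  proof -
    have "B = {z \<in> sector e k. P (chart e k z)}" using that by blast
    then show ?thesis by (auto simp flip: homeomorphism_image1[OF hom])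
  qed
  have "chart e k ` stable_branch k = {z \<in> model_sector. z $ 1 = 0 \<and> z $ 2 > 0}"
    by (rule preimage[OF sub(1)])
       (use c_pos e in \<open>auto simp: stable_branch_def sector_def chart_def zero_less_divide_iff\<close>)
  moreover have "chart e k ` unstable_branch e = {z \<in> model_sector. z $ 1 > 0 \<and> z $ 2 = 0}"
    by (rule preimage[OF sub(2)])
       (use c_pos k in \<open>auto simp: unstable_branch_def sector_def chart_def zero_less_divide_iff\<close>)
  moreover have "reaches (newton_field f) (sector e k) z w \<longleftrightarrow>
      reaches model_field model_sector (chart e k z) (chart e k w)"
    if "z \<in> sector e k" "w \<in> sector e k" for z w
  proof -
    have "reaches model_field model_sector (chart e k z) (chart e k w)
        \<longleftrightarrow> (\<exists>l\<ge>1. u w = l * u z \<and> v z = l * v w)"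
      unfolding model_reaches_iff[OF chart_in_model[OF e k that(1)] chart_in_model[OF e k that(2)]]
      using e k c_pos by (auto simp: chart_def)
    then show ?thesis
      using sector_reaches_imp[OF e k] sector_reaches[OF e k that] by blast
  qed
  moreover have "origin \<in> sector e k" "chart e k origin = 0"
    using origin_in_box by (simp_all add: sector_def chart_def vec2_eq_iff)
  ultimately show ?thesis
    unfolding hyperbolic_sector_def using sub hom by blast
qed

text \<open>For j = 1 this is the curve y = s(p) of the field itself, for j = -1 the curve y = -s(p)
  of the reversed field; in both cases p' = s(p). With the distance \<tau> from
  \<open>p\<^sub>0\<close> as parameter the speed is |s|, which is at most
  \<open>sqrt (2 * L) * \<tau>\<close>. The nonzero one of u and v has modulus 2|s|, whence the
  bound by c.\<close>

lemma branch_outgoing: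
  assumes e: "e = 1 \<or> e = - 1" and j: "j = 1 \<or> j = - 1"
  shows "outgoing_separatrix (\<lambda>z. j *\<^sub>R newton_field f z) origin
    {z. z $ 1 \<in> I \<and> \<bar>2 * s (z $ 1)\<bar> \<le> c \<and> z $ 2 = j * s (z $ 1) \<and> 0 < e * s (z $ 1)}"
    (is "outgoing_separatrix _ _ ?B")
proof -
  have ee: "e * e = 1" "\<And>a. e * (e * a) = a" using e by auto
  \<comment> \<open>The end point of the branch, on the boundary of the box: there 2|s| = c.\<close>
  define x where "x = \<sigma> (e * c / 2)"
  define b where "b = e * (x - p\<^sub>0)"
  have x: "x \<in> I" "s x = e * c / 2"
    using s_\<sigma>[of "e * c / 2"] e c_pos unfolding x_def by auto
  have "0 < b"
    using e c_pos s_pos_iff[OF x(1)] s_neg_iff[OF x(1)] x(2) unfolding b_def by auto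
  have "b \<le> \<delta>" using x(1) e unfolding b_def by auto
  have xb: "x = p\<^sub>0 + e * b" by (simp add: b_def ee)
  have mem: "p\<^sub>0 + e * \<tau> \<in> I" "p\<^sub>0 + e * \<tau> \<noteq> p\<^sub>0" "0 < e * s (p\<^sub>0 + e * \<tau>)" if "\<tau> \<in> {0<..b}" for \<tau>
  proof -
    show I: "p\<^sub>0 + e * \<tau> \<in> I" and "p\<^sub>0 + e * \<tau> \<noteq> p\<^sub>0" using that \<open>b \<le> \<delta>\<close> e by auto
    show "0 < e * s (p\<^sub>0 + e * \<tau>)" using s_pos_iff[OF I] s_neg_iff[OF I] e that by auto
  qed
  show ?thesis
  proof (rule outgoing_separatrix_curve[OF \<open>0 < b\<close>, where G="\<lambda>\<tau>. e * s (p\<^sub>0 + e * \<tau>)" and M="sqrt (2 * L)"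
        and X="\<lambda>\<tau>. p\<^sub>0 + e * \<tau>" and Y="\<lambda>\<tau>. j * s (p\<^sub>0 + e * \<tau>)" and X'="\<lambda>_. e"
        and Y'="\<lambda>\<tau>. j * (f (p\<^sub>0 + e * \<tau>) / s (p\<^sub>0 + e * \<tau>) * e)"])
    show "continuous_on {0<..b} (\<lambda>\<tau>. e * s (p\<^sub>0 + e * \<tau>))"
      using mem(1) by (intro continuous_intros continuous_on_compose2[OF s_cont]) auto
    show "((\<lambda>\<tau>. p\<^sub>0 + e * \<tau>) \<longlongrightarrow> origin $ 1) (at_right 0)"
      by (auto intro!: tendsto_eq_intros)
    have "\<bar>j * s (p\<^sub>0 + e * \<tau>)\<bar> \<le> sqrt (2 * L) * \<tau>" if "\<tau> \<in> {0<..b}" for \<tau>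
      using s_bound[OF mem(1)[OF that]] e j that by (auto simp: abs_mult)
    then have "\<forall>\<^sub>F \<tau> in at_right 0. norm (j * s (p\<^sub>0 + e * \<tau>)) \<le> sqrt (2 * L) * \<tau>"
      using \<open>0 < b\<close> unfolding eventually_at_right_field by (intro exI[of _ b]) auto
    moreover have "((\<lambda>\<tau>. sqrt (2 * L) * \<tau>) \<longlongrightarrow> 0) (at_right 0)"
      by (auto intro!: tendsto_eq_intros)
    ultimately show "((\<lambda>\<tau>. j * s (p\<^sub>0 + e * \<tau>)) \<longlongrightarrow> origin $ 2) (at_right 0)"
      by (simp add: Lim_null_comparison)
    show "origin \<notin> ?B" by simp
    show "?B = (\<lambda>\<tau>. vector [p\<^sub>0 + e * \<tau>, j * s (p\<^sub>0 + e * \<tau>)]) ` {0<..b}" (is "_ = ?g ` _")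
    proof (intro equalityI subsetI)
      fix z assume z: "z \<in> ?B"
      let ?\<tau> = "e * (z $ 1 - p\<^sub>0)"
      have "0 < ?\<tau>" using z s_pos_iff[of "z $ 1"] s_neg_iff[of "z $ 1"] e by auto
      moreover have "e * s (z $ 1) \<le> e * s x" using z e unfolding x(2) by auto
      then have "?\<tau> \<le> b" using z x(1) e unfolding b_def by (auto simp: s_le_iff)
      moreover have "z = ?g ?\<tau>" using z by (simp add: vec2_eq_iff ee)
      ultimately show "z \<in> ?g ` {0<..b}" by auto
    next
      fix z assume "z \<in> ?g ` {0<..b}"
      then obtain \<tau> where \<tau>: "\<tau> \<in> {0<..b}" "z = ?g \<tau>" by auto
      have "e * s (p\<^sub>0 + e * \<tau>) \<le> e * s (p\<^sub>0 + e * b)"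
        using \<tau>(1) mem(1)[OF \<tau>(1)] x(1) e unfolding xb by (auto simp: s_le_iff)
      then have "e * s (p\<^sub>0 + e * \<tau>) \<le> c / 2" unfolding xb[symmetric] x(2) by (simp add: ee)
      then show "z \<in> ?B" using mem[OF \<tau>(1)] \<tau>(2) e by auto
    qed
    fix \<tau> assume \<tau>: "\<tau> \<in> {0<..b}"
    note mem = mem[OF \<tau>]
    show "0 < e * s (p\<^sub>0 + e * \<tau>)" using mem(3) .
    show "e * s (p\<^sub>0 + e * \<tau>) \<le> sqrt (2 * L) * \<tau>"
      using s_bound[OF mem(1)] e \<tau> by (auto simp: abs_mult)
    show "((\<lambda>\<tau>. p\<^sub>0 + e * \<tau>) has_real_derivative e) (at \<tau>)" by (auto intro!: derivative_eq_intros)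
    then show "((\<lambda>\<tau>. j * s (p\<^sub>0 + e * \<tau>)) has_real_derivative
        j * (f (p\<^sub>0 + e * \<tau>) / s (p\<^sub>0 + e * \<tau>) * e)) (at \<tau>)"
      by (intro DERIV_cmult DERIV_chain2[where f=s and g="\<lambda>\<tau>. p\<^sub>0 + e * \<tau>", OF s_deriv[OF mem(1,2)]])
    have "s (p\<^sub>0 + e * \<tau>) \<noteq> 0" using mem(3) by auto
    then show "j *\<^sub>R newton_field f (vector [p\<^sub>0 + e * \<tau>, j * s (p\<^sub>0 + e * \<tau>)])
        = vector [e * s (p\<^sub>0 + e * \<tau>) * e,
            e * s (p\<^sub>0 + e * \<tau>) * (j * (f (p\<^sub>0 + e * \<tau>) / s (p\<^sub>0 + e * \<tau>) * e))]"
      using e j by (auto simp: vec2_eq_iff)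
  qed
qed

lemma unstable_branch_outgoing:
  assumes "e = 1 \<or> e = - 1"
  shows "outgoing_separatrix (newton_field f) origin (unstable_branch e)"
proof -
  have "unstable_branch e =
      {z. z $ 1 \<in> I \<and> \<bar>2 * s (z $ 1)\<bar> \<le> c \<and> z $ 2 = 1 * s (z $ 1) \<and> 0 < e * s (z $ 1)}"
    using assms c_pos by (auto simp: unstable_branch_def chart_box_def u_def v_def)
  then show ?thesis using branch_outgoing[OF assms, of 1] by simp
qed

lemma stable_branch_incoming:
  assumes "k = 1 \<or> k = - 1"
  shows "incoming_separatrix (newton_field f) origin (stable_branch k)"
proof -
  have "stable_branch k =
      {z. z $ 1 \<in> I \<and> \<bar>2 * s (z $ 1)\<bar> \<le> c \<and> z $ 2 = - 1 * s (z $ 1) \<and> 0 < - k * s (z $ 1)}"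
    using assms c_pos by (auto simp: stable_branch_def chart_box_def u_def v_def)
  then show ?thesis
    \<comment> \<open>On u = 0 one has v = -2 s(p), so the sign k of v means the sign -k of
      s.\<close>
    using branch_outgoing[of "- k" "- 1"] assms by (intro incoming_separatrix_reverse) auto
qed

section \<open>Assembly of the four sectors\<close>

theorem saddle: "is_saddle (newton_field f) origin"
proof -
  have "sector 1 1 \<union> sector 1 (- 1) \<union> sector (- 1) (- 1) \<union> sector (- 1) 1 = chart_box"
    by (auto simp: sector_def)
  then have "origin \<in> interior (sector 1 1 \<union> sector 1 (- 1) \<union> sector (- 1) (- 1) \<union> sector (- 1) 1)"
    using origin_interior by simp
  moreover have "sector 1 1 \<inter> sector 1 (- 1) = insert origin (unstable_branch 1)"
    "sector 1 (- 1) \<inter> sector (- 1) (- 1) = insert origin (stable_branch (- 1))"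
    "sector (- 1) (- 1) \<inter> sector (- 1) 1 = insert origin (unstable_branch (- 1))"
    "sector (- 1) 1 \<inter> sector 1 1 = insert origin (stable_branch 1)"
    "sector 1 1 \<inter> sector (- 1) (- 1) = {origin}"
    "sector 1 (- 1) \<inter> sector (- 1) 1 = {origin}"
    using uv_zero_iff origin_in_box
    by (fastforce simp: sector_def stable_branch_def unstable_branch_def)+
  moreover have "equilibrium (newton_field f) origin"
    by (simp add: equilibrium_def vec2_eq_iff)
  moreover have "1 = (1::real) \<or> 1 = (- 1::real)" "- 1 = (1::real) \<or> - 1 = (- 1::real)" by simp_all
  note sector_hyperbolic[OF this(1) this(1)] sector_hyperbolic[OF this(1) this(2)]
    sector_hyperbolic[OF this(2) this(2)] sector_hyperbolic[OF this(2) this(1)]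
    this[THEN stable_branch_incoming] this[THEN unstable_branch_outgoing]
  ultimately show ?thesis
    unfolding is_saddle_def
    by - (rule conjI, assumption,
      rule exI[of _ "sector 1 1"], rule exI[of _ "sector 1 (- 1)"],
      rule exI[of _ "sector (- 1) (- 1)"], rule exI[of _ "sector (- 1) 1"],
      rule exI[of _ "stable_branch 1"], rule exI[of _ "stable_branch (- 1)"],
      rule exI[of _ "unstable_branch 1"], rule exI[of _ "unstable_branch (- 1)"], intro conjI)
qed

end

section \<open>Centers\<close>

text \<open>A replacement for the Jordan curve theorem: D cuts the component of x in the complement
  of C in a set that is both open and closed in it, so the component lies in the bounded set
  D.\<close>

lemma inside_of_clopen:
  assumes "closed D" "bounded D" "open (D - C)" "x \<in> D - C"
  shows "x \<in> inside C"
proof -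
  let ?K = "connected_component_set (- C) x"
  have K: "?K \<subseteq> - C" "x \<in> ?K"
    using assms(4) connected_component_subset[of "- C" x] by auto
  have eq: "?K \<inter> D = ?K \<inter> (D - C)" using K(1) by blast
  have "closedin (top_of_set ?K) (?K \<inter> D)" using \<open>closed D\<close> by (rule closedin_closed_Int)
  moreover have "openin (top_of_set ?K) (?K \<inter> D)" unfolding eq using assms(3) by (rule openin_open_Int)
  ultimately have "?K \<inter> D = {} \<or> ?K \<inter> D = ?K"
    using connected_connected_component[of "- C" x] unfolding connected_clopen by blast
  then have "?K \<subseteq> D" using K(2) assms(4) by blast
  then show ?thesis
    using assms(2,4) unfolding inside_def by (auto intro: bounded_subset)
qed

text \<open>The compact sublevel set is the D of \<open>inside_of_clopen\<close>; removing the level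
  leaves the strict sublevel set, which is open. Thus x lies inside each level curve in U.\<close>

lemma center_of_energy:
  fixes H :: "real^2 \<Rightarrow> real"
  assumes "equilibrium F x" "open U" "x \<in> U" and cont: "continuous_on UNIV H"
    and min: "\<And>z. z \<in> U - {x} \<Longrightarrow> H x < H z"
    and compact: "\<And>z. z \<in> U - {x} \<Longrightarrow> compact {w \<in> U. H w \<le> H z}"
    and orbit: "\<And>z. z \<in> U - {x} \<Longrightarrow> periodic_orbit F {w \<in> U. H w = H z}"
  shows "is_center F x"
  unfolding is_center_def
proof (rule conjI, fact, rule exI[of _ U], intro conjI ballI)
  fix z assume z: "z \<in> U - {x}"
  let ?C = "{w \<in> U. H w = H z}" and ?D = "{w \<in> U. H w \<le> H z}"
  have "?D - ?C = U \<inter> H -` {..<H z}" by auto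
  moreover have "open (U \<inter> H -` {..<H z})"
    using \<open>open U\<close> by (intro continuous_open_preimage continuous_on_subset[OF cont]) auto
  ultimately have "x \<in> inside ?C"
    using min[OF z] \<open>x \<in> U\<close> compact[OF z]
    by (intro inside_of_clopen[of ?D]) (auto intro: compact_imp_closed compact_imp_bounded)
  then show "\<exists>C. periodic_orbit F C \<and> z \<in> C \<and> C \<subseteq> U - {x} \<and> x \<in> inside C"
    using orbit[OF z] min[OF z] z by (intro exI[of _ ?C]) auto
qed (use assms in auto)

lemma bounded_vec2:
  assumes "\<And>z. z \<in> S \<Longrightarrow> \<bar>z $ 1\<bar> \<le> A" "\<And>z. z \<in> S \<Longrightarrow> (z $ 2)\<^sup>2 \<le> B"
  shows "bounded (S :: (real^2) set)"
proof (rule boundedI)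
  fix z assume z: "z \<in> S"
  have "norm z \<le> \<bar>z $ 1\<bar> + \<bar>z $ 2\<bar>" using norm_le_l1_cart[of z] by (simp add: sum_2)
  also have "\<dots> \<le> A + sqrt B"
    using assms[OF z] by (intro add_mono) (auto intro: real_le_rsqrt)
  finally show "norm z \<le> A + sqrt B" .
qed

text \<open>The orbits are \<open>p = A sin \<theta>\<close>, \<open>y = A q(\<theta>) cos \<theta>\<close> with
  \<open>q(\<theta>)\<^sup>2 = -\<alpha> + \<beta> A\<^sup>2 (1 + sin\<^sup>2 \<theta>) / 2\<close> and \<open>\<theta>' = q(\<theta>)\<close>: this is the amplitude
  function of the Jacobian elliptic integrals.\<close>

lemma cubic_center_zero:
  fixes \<alpha> \<beta> M :: real
  assumes "M > 0" and restoring: "\<And>p. 0 < p \<Longrightarrow> p < M \<Longrightarrow> 0 < - \<alpha> + \<beta> * p\<^sup>2"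
  shows "is_center (newton_field (\<lambda>p. \<alpha> * p - \<beta> * p ^ 3)) (vector [0, 0])"
proof -
  let ?f = "\<lambda>p. \<alpha> * p - \<beta> * p ^ 3"
  define V where "V p = - \<alpha> * p\<^sup>2 / 2 + \<beta> * p ^ 4 / 4" for p
  define H where "H z = (z $ 2)\<^sup>2 / 2 + V (z $ 1)" for z :: "real^2"
  \<comment> \<open>The bound on the position is essential: beyond a potential barrier the energy
    may fall below V M again.\<close>
  define U where "U = {z. \<bar>z $ 1\<bar> < M \<and> H z < V M}"
  have contV: "continuous_on T V" for T unfolding V_def by (intro continuous_intros) auto
  have V_less: "V x < V y" if "0 \<le> x" "x < y" "y \<le> M" for x y
  proof (rule DERIV_pos_imp_increasing_open[OF \<open>x < y\<close>])
    fix p assume p: "x < p" "p < y"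
    have "(V has_real_derivative p * (- \<alpha> + \<beta> * p\<^sup>2)) (at p)"
      unfolding V_def by (auto intro!: derivative_eq_intros simp: algebra_simps power2_eq_square power3_eq_cube)
    moreover have "0 < p * (- \<alpha> + \<beta> * p\<^sup>2)" using p that restoring[of p] by simp
    ultimately show "\<exists>d. (V has_real_derivative d) (at p) \<and> 0 < d" by blast
  qed (rule contV)
  have V_even: "V p = V \<bar>p\<bar>" for p by (simp add: V_def)
  have V0: "V 0 = 0" by (simp add: V_def)
  have V_nonneg: "0 \<le> V p" if "\<bar>p\<bar> \<le> M" for p
    using V_less[of 0 "\<bar>p\<bar>"] that V_even[of p] V0 by (cases "p = 0") auto
  have contH: "continuous_on UNIV H"
    unfolding H_def V_def by (intro continuous_intros) auto
  have zero: "vector [0, 0] = (0 :: real^2)" by (simp add: vec2_eq_iff)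
  have "H 0 = 0" by (simp add: H_def V0)
  show ?thesis
    unfolding zero
  proof (rule center_of_energy[where U=U and H=H])
    show "equilibrium (newton_field ?f) 0" by (simp add: equilibrium_def vec2_eq_iff)
    have "U = (\<lambda>z. \<bar>z $ 1\<bar>) -` {..<M} \<inter> H -` {..<V M}" by (auto simp: U_def)
    then show "open U"
      using contH by (simp only:) (intro open_Int open_vimage continuous_intros, auto)
    show "0 \<in> U" using \<open>M > 0\<close> V_less[of 0 M] by (simp add: U_def \<open>H 0 = 0\<close> V0)
    show "continuous_on UNIV H" by (rule contH)
    fix z assume z: "z \<in> U - {0}"
    have Hz: "0 < H z"
    proof (cases "z $ 1 = 0")
      case True
      then have "z $ 2 \<noteq> 0" using z by (auto simp: vec2_eq_iff)
      then show ?thesis by (simp add: H_def True V0)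
    next
      case False
      then have "0 < V (z $ 1)"
        using V_less[of 0 "\<bar>z $ 1\<bar>"] z V_even[of "z $ 1"] V0 by (auto simp: U_def)
      then show ?thesis by (simp add: H_def add_nonneg_pos)
    qed
    then show "H 0 < H z" by (simp add: \<open>H 0 = 0\<close>)
    \<comment> \<open>A is the amplitude, the turning point of the orbit through z.\<close>
    obtain A where A: "0 < A" "A < M" "V A = H z"
    proof -
      have "H z < V M" using z by (simp add: U_def)
      then obtain A where "0 \<le> A" "A \<le> M" "V A = H z"
        using IVT'[of V 0 "H z" M] Hz V0 \<open>M > 0\<close> contV by auto
      moreover from this have "A \<noteq> 0" "A \<noteq> M" using V0 Hz \<open>H z < V M\<close> by auto
      ultimately show ?thesis using that[of A] by simp
    qed
    have le_A: "\<bar>w $ 1\<bar> \<le> A" if "\<bar>w $ 1\<bar> < M" "H w \<le> H z" for w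
    proof (rule ccontr)
      assume "\<not> \<bar>w $ 1\<bar> \<le> A"
      then have "V A < V \<bar>w $ 1\<bar>" using V_less[of A "\<bar>w $ 1\<bar>"] A that by auto
      moreover have "V \<bar>w $ 1\<bar> \<le> H w" using V_even[of "w $ 1"] by (simp add: H_def)
      ultimately show False using that A by simp
    qed
    have "V A < V M" using V_less[of A M] A by simp
    show "compact {w \<in> U. H w \<le> H z}"
    proof -
      have eq: "{w \<in> U. H w \<le> H z} = {w. \<bar>w $ 1\<bar> \<le> A \<and> H w \<le> H z}"
        using le_A A \<open>V A < V M\<close> by (auto simp: U_def)
      have "closed {w. \<bar>w $ 1\<bar> \<le> A \<and> H w \<le> H z}"
        by (intro closed_Collect_conj closed_Collect_le contH continuous_intros)
      moreover have "bounded {w. \<bar>w $ 1\<bar> \<le> A \<and> H w \<le> H z}"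
      proof (rule bounded_vec2)
        fix w assume "w \<in> {w. \<bar>w $ 1\<bar> \<le> A \<and> H w \<le> H z}"
        then show "\<bar>w $ 1\<bar> \<le> A" "(w $ 2)\<^sup>2 \<le> 2 * H z"
          using V_nonneg[of "w $ 1"] A by (auto simp: H_def)
      qed
      ultimately show ?thesis unfolding eq by (simp add: compact_eq_bounded_closed)
    qed
    \<comment> \<open>From the factorisation 2 (V A - V p) = (A^2 - p^2) Q(p^2/A^2), with S standing
      for the squared sine.\<close>
    define Q where "Q S = - \<alpha> + \<beta> * A\<^sup>2 * (1 + S) / 2" for S
    have Q_pos: "0 < Q S" if "0 \<le> S" "S \<le> 1" for S
    proof -
      \<comment> \<open>Chosen so that Q S = -\<alpha> + \<beta> p^2 at a position p <= A < M, where
        the force is restoring.\<close>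
      let ?p = "A * sqrt ((1 + S) / 2)"
      have "0 < ?p" using A that by simp
      moreover have "?p \<le> A * 1" using A that by (intro mult_left_mono) auto
      then have "?p < M" using A by linarith
      ultimately have "0 < - \<alpha> + \<beta> * ?p\<^sup>2" by (intro restoring)
      then show ?thesis using that by (simp add: Q_def power_mult_distrib)
    qed
    have sin2: "0 \<le> (sin \<tau>)\<^sup>2" "(sin \<tau>)\<^sup>2 \<le> 1" for \<tau> :: real
      by (auto simp: abs_square_le_1)
    define q where "q \<tau> = sqrt (Q ((sin \<tau>)\<^sup>2))" for \<tau>
    have q_pos: "0 < q \<tau>" for \<tau> unfolding q_def using Q_pos[OF sin2] by simp
    have q_sq: "(q \<tau>)\<^sup>2 = Q ((sin \<tau>)\<^sup>2)" for \<tau>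
      unfolding q_def using Q_pos[OF sin2, of \<tau>] by simp
    let ?X = "\<lambda>\<tau>. A * sin \<tau>" and ?Y = "\<lambda>\<tau>. A * cos \<tau> * q \<tau>"
    have level: "H (vector [A * x, A * y * sqrt (Q (x\<^sup>2))]) = V A" if "x\<^sup>2 + y\<^sup>2 = 1" for x y
    proof -
      have "x\<^sup>2 \<le> 1" using that zero_le_power2[of y] by linarith
      then have "(sqrt (Q (x\<^sup>2)))\<^sup>2 = Q (x\<^sup>2)" using Q_pos[of "x\<^sup>2"] by simp
      moreover have "y\<^sup>2 = 1 - x\<^sup>2" using that by simp
      ultimately have "H (vector [A * x, A * y * sqrt (Q (x\<^sup>2))]) = A\<^sup>2 * (1 - x\<^sup>2) * Q (x\<^sup>2) / 2 + V (A * x)"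
        by (simp add: H_def power_mult_distrib)
      also have "\<dots> = V A"
        unfolding V_def Q_def by (simp add: field_simps power2_eq_square power4_eq_xxxx)
      finally show ?thesis .
    qed
    have dq: "(q has_real_derivative \<beta> * A\<^sup>2 * sin \<tau> * cos \<tau> / (2 * q \<tau>)) (at \<tau>)" for \<tau>
      using Q_pos[OF sin2, of \<tau>] unfolding q_def Q_def
      by (auto intro!: derivative_eq_intros simp: field_simps)
    have "periodic_orbit (newton_field ?f) (range (\<lambda>\<tau>. vector [?X \<tau>, ?Y \<tau>]))"
    proof (rule periodic_orbit_curve[where G=q and L="2 * pi" and M="sqrt (\<bar>\<alpha>\<bar> + \<bar>\<beta>\<bar> * A\<^sup>2)"
          and X'="\<lambda>\<tau>. A * cos \<tau>"
          and Y'="\<lambda>\<tau>. A * (- sin \<tau> * q \<tau> + cos \<tau> * (\<beta> * A\<^sup>2 * sin \<tau> * cos \<tau> / (2 * q \<tau>)))"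
          and s=0 and t="pi / 2"])
      show "continuous_on UNIV q"
        unfolding q_def Q_def by (intro continuous_intros) auto
      show "q \<tau> \<le> sqrt (\<bar>\<alpha>\<bar> + \<bar>\<beta>\<bar> * A\<^sup>2)" for \<tau>
      proof -
        have "\<beta> * (A\<^sup>2 * ((1 + (sin \<tau>)\<^sup>2) / 2)) \<le> \<bar>\<beta>\<bar> * (A\<^sup>2 * 1)"
          using sin2[of \<tau>] by (intro mult_mono mult_left_mono) auto
        then show ?thesis unfolding q_def Q_def by simp
      qed
      show "newton_field ?f (vector [?X \<tau>, ?Y \<tau>]) = vector [q \<tau> * (A * cos \<tau>),
          q \<tau> * (A * (- sin \<tau> * q \<tau> + cos \<tau> * (\<beta> * A\<^sup>2 * sin \<tau> * cos \<tau> / (2 * q \<tau>))))]" for \<tau>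
      proof -
        have "q \<tau> * (A * (- sin \<tau> * q \<tau> + cos \<tau> * (\<beta> * A\<^sup>2 * sin \<tau> * cos \<tau> / (2 * q \<tau>))))
            = A * (- sin \<tau> * (q \<tau>)\<^sup>2 + (cos \<tau>)\<^sup>2 * (\<beta> * A\<^sup>2 * sin \<tau>) / 2)"
          using q_pos[of \<tau>] by (simp add: field_simps power2_eq_square)
        also have "\<dots> = ?f (A * sin \<tau>)"
          unfolding q_sq Q_def cos_squared_eq
          by (simp add: field_simps power2_eq_square power3_eq_cube)
        finally show ?thesis by (simp add: vec2_eq_iff)
      qed
      show "(?Y has_real_derivative
          A * (- sin \<tau> * q \<tau> + cos \<tau> * (\<beta> * A\<^sup>2 * sin \<tau> * cos \<tau> / (2 * q \<tau>)))) (at \<tau>)" for \<tau>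
        by (auto intro!: derivative_eq_intros dq simp: algebra_simps)
      show "q (\<tau> + 2 * pi) = q \<tau>" for \<tau> by (simp add: q_def)
      then show "?Y (\<tau> + 2 * pi) = ?Y \<tau>" for \<tau> by simp
    qed (use q_pos A in \<open>auto intro!: derivative_eq_intros\<close>)
    moreover have "range (\<lambda>\<tau>. vector [?X \<tau>, ?Y \<tau>] :: real^2) = {w \<in> U. H w = H z}"
    proof (intro equalityI subsetI)
      fix w :: "real^2" assume "w \<in> range (\<lambda>\<tau>. vector [?X \<tau>, ?Y \<tau>])"
      then obtain \<tau> where \<tau>: "w = vector [?X \<tau>, ?Y \<tau>]" by blast
      have "H w = V A" unfolding \<tau> q_def by (rule level) simp
      moreover have "\<bar>A * sin \<tau>\<bar> \<le> A * 1"
        using A abs_sin_le_one[of \<tau>] unfolding abs_mult by (intro mult_mono) auto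
      ultimately show "w \<in> {w \<in> U. H w = H z}" using A \<open>V A < V M\<close> by (simp add: U_def \<tau>)
    next
      fix w :: "real^2" assume w: "w \<in> {w \<in> U. H w = H z}"
      define x where "x = w $ 1 / A"
      have "\<bar>w $ 1\<bar> \<le> A" using le_A[of w] w by (auto simp: U_def)
      then have x2: "x\<^sup>2 \<le> 1" using A by (simp add: x_def abs_square_le_1)
      then have Qx: "0 < Q (x\<^sup>2)" by (intro Q_pos) auto
      define y where "y = w $ 2 / (A * sqrt (Q (x\<^sup>2)))"
      have w_eq: "w = vector [A * x, A * y * sqrt (Q (x\<^sup>2))]"
        using A Qx by (simp add: vec2_eq_iff x_def y_def)
      have "y\<^sup>2 + x\<^sup>2 = 1"
      proof -
        \<comment> \<open>By \<open>level\<close> the point with x' in place of y has the same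
          position and energy, so y and x' agree up to sign.\<close>
        define x' where "x' = sqrt (1 - x\<^sup>2)"
        have x': "x\<^sup>2 + x'\<^sup>2 = 1" using x2 by (simp add: x'_def)
        have "H w = H (vector [A * x, A * x' * sqrt (Q (x\<^sup>2))])"
          using level[OF x'] w A by simp
        then have "(A * y * sqrt (Q (x\<^sup>2)))\<^sup>2 = (A * x' * sqrt (Q (x\<^sup>2)))\<^sup>2"
          by (subst (asm) w_eq) (simp add: H_def)
        then have "y\<^sup>2 = x'\<^sup>2" using A Qx by (simp add: power_mult_distrib)
        then show ?thesis using x' by simp
      qed
      then obtain \<tau> where "y = cos \<tau>" "x = sin \<tau>" using sincos_total_2pi by metis
      then show "w \<in> range (\<lambda>\<tau>. vector [?X \<tau>, ?Y \<tau>])"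
        unfolding w_eq q_def by blast
    qed
    ultimately show "periodic_orbit (newton_field ?f) {w \<in> U. H w = H z}" by simp
  qed
qed

text \<open>Here \<open>m y\<close> and \<open>p\<^sup>2 - k\<close> run on circles, since the first integral is
  \<open>(m\<^sup>2y\<^sup>2 + (p\<^sup>2 - k)\<^sup>2) / (2m\<^sup>2)\<close> for \<open>m\<^sup>2 = 2/\<beta>\<close>; the angular speed is \<open>\<beta> m \<bar>p\<bar>\<close>.\<close>

lemma cubic_center_nonzero:
  fixes \<beta> k e :: real
  assumes "\<beta> > 0" "k > 0" and e: "e = 1 \<or> e = - 1"
  shows "is_center (newton_field (\<lambda>p. \<beta> * k * p - \<beta> * p ^ 3)) (vector [e * sqrt k, 0])"
proof -
  let ?f = "\<lambda>p. \<beta> * k * p - \<beta> * p ^ 3"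
  define H where "H z = (z $ 2)\<^sup>2 / 2 + \<beta> * ((z $ 1)\<^sup>2 - k)\<^sup>2 / 4" for z :: "real^2"
  \<comment> \<open>The bound is the energy of the saddle at the origin between the two wells; the
    sign condition selects one well.\<close>
  define U where "U = {z. 0 < e * z $ 1 \<and> H z < \<beta> * k\<^sup>2 / 4}"
  define m where "m = sqrt (2 / \<beta>)"
  have m: "0 < m" "\<beta> * m\<^sup>2 = 2"
    using \<open>\<beta> > 0\<close> by (auto simp: m_def)
  then have m3: "\<beta> * m * m = 2" by (simp add: power2_eq_square)
  have ee: "e\<^sup>2 = 1" "e * e = 1" "\<And>a. e * (e * a) = a" "e \<noteq> 0" using e by auto
  have contH: "continuous_on UNIV H"
    unfolding H_def by (intro continuous_intros) auto
  have Hp: "H (vector [e * sqrt k, 0]) = 0"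
    using \<open>k > 0\<close> by (simp add: H_def power_mult_distrib ee)
  show ?thesis
  proof (rule center_of_energy[where U=U and H=H])
    show "equilibrium (newton_field ?f) (vector [e * sqrt k, 0])"
      using \<open>k > 0\<close> e by (auto simp: equilibrium_def vec2_eq_iff power3_eq_cube)
    have "U = (\<lambda>z. e * z $ 1) -` {0<..} \<inter> H -` {..<\<beta> * k\<^sup>2 / 4}" by (auto simp: U_def)
    then show "open U"
      using contH by (simp only:) (intro open_Int open_vimage continuous_intros, auto)
    show "vector [e * sqrt k, 0] \<in> U" using assms by (simp add: U_def Hp ee)
    show "continuous_on UNIV H" by (rule contH)
    fix z assume z: "z \<in> U - {vector [e * sqrt k, 0]}"
    have "H z \<noteq> 0"
    proof
      assume "H z = 0"
      moreover have "0 \<le> \<beta> * ((z $ 1)\<^sup>2 - k)\<^sup>2" using \<open>\<beta> > 0\<close> by simp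
      ultimately have "\<beta> * ((z $ 1)\<^sup>2 - k)\<^sup>2 = 0" "(z $ 2)\<^sup>2 = 0"
        unfolding H_def using zero_le_power2[of "z $ 2"] by linarith+
      then have "z $ 2 = 0" "(e * z $ 1)\<^sup>2 = k" using \<open>\<beta> > 0\<close> by (auto simp: power_mult_distrib ee)
      moreover from this(2) have "e * z $ 1 = sqrt k" using z by (auto simp: U_def)
      then have "z $ 1 = e * sqrt k" using ee(3)[of "z $ 1"] by simp
      ultimately show False using z by (simp add: vec2_eq_iff)
    qed
    moreover have "0 \<le> H z" using \<open>\<beta> > 0\<close> by (simp add: H_def)
    ultimately have Hz: "0 < H z" by simp
    then show "H (vector [e * sqrt k, 0]) < H z" by (simp add: Hp)
    have Hk: "H z < \<beta> * k\<^sup>2 / 4" using z by (simp add: U_def)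
    show "compact {w \<in> U. H w \<le> H z}"
    proof -
      have "e * w $ 1 \<noteq> 0" if "H w \<le> H z" for w
      proof
        assume "e * w $ 1 = 0"
        then have "H w \<ge> \<beta> * k\<^sup>2 / 4" using ee(4) by (simp add: H_def)
        then show False using that Hk by simp
      qed
      \<comment> \<open>Below the barrier energy the line p = 0 is not met, so the strict inequality
        may be relaxed to a closed condition.\<close>
      then have eq: "{w \<in> U. H w \<le> H z} = {w. 0 \<le> e * w $ 1 \<and> H w \<le> H z}"
        using Hk unfolding U_def by (auto simp: less_le)
      have "closed {w. 0 \<le> e * w $ 1 \<and> H w \<le> H z}"
        by (intro closed_Collect_conj closed_Collect_le contH continuous_intros)
      moreover have "bounded {w. 0 \<le> e * w $ 1 \<and> H w \<le> H z}"
      proof (rule bounded_vec2)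
        fix w assume "w \<in> {w. 0 \<le> e * w $ 1 \<and> H w \<le> H z}"
        then have w: "H w \<le> H z" by simp
        have Hw: "H w = (w $ 2)\<^sup>2 / 2 + \<beta> * ((w $ 1)\<^sup>2 - k)\<^sup>2 / 4" by (simp add: H_def)
        have "0 \<le> \<beta> * ((w $ 1)\<^sup>2 - k)\<^sup>2" using \<open>\<beta> > 0\<close> by simp
        then show "(w $ 2)\<^sup>2 \<le> 2 * H z" using w Hw by linarith
        have "\<beta> * ((w $ 1)\<^sup>2 - k)\<^sup>2 \<le> \<beta> * k\<^sup>2"
          using w Hw Hk zero_le_power2[of "w $ 2"] by linarith
        then have "\<bar>(w $ 1)\<^sup>2 - k\<bar> \<le> k"
          using assms by (simp add: abs_le_square_iff[symmetric])
        then have "(w $ 1)\<^sup>2 \<le> 2 * k" by simp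
        then show "\<bar>w $ 1\<bar> \<le> sqrt (2 * k)" by (intro real_le_rsqrt) simp
      qed
      ultimately show ?thesis unfolding eq by (simp add: compact_eq_bounded_closed)
    qed
    define R where "R = sqrt (2 * H z)"
    have R: "0 < R" "R\<^sup>2 = 2 * H z" using Hz by (simp_all add: R_def)
    \<comment> \<open>Energy below the barrier means m R < k, which keeps p^2 = k + m R sin \<tau>
      positive along the whole circle.\<close>
    have "(m * R)\<^sup>2 < k\<^sup>2"
    proof -
      have "\<beta> * (m * R)\<^sup>2 = 4 * H z" by (simp add: power_mult_distrib R(2) m(2) mult.assoc[symmetric])
      then have "\<beta> * (m * R)\<^sup>2 < \<beta> * k\<^sup>2" using Hk by simp
      then show ?thesis using \<open>\<beta> > 0\<close> by simp
    qed
    then have "m * R < k" by (rule power2_less_imp_less) (use \<open>k > 0\<close> in simp)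
    have pos: "0 < k + m * R * sin \<tau>" for \<tau>
    proof -
      have "m * R * (- sin \<tau>) \<le> m * R * 1"
        using m R sin_ge_minus_one[of \<tau>] by (intro mult_left_mono) auto
      then show ?thesis using \<open>m * R < k\<close> by simp
    qed
    define q where "q \<tau> = sqrt (k + m * R * sin \<tau>)" for \<tau>
    have q_pos: "0 < q \<tau>" and q_sq: "(q \<tau>)\<^sup>2 = k + m * R * sin \<tau>" for \<tau>
      using pos[of \<tau>] by (simp_all add: q_def)
    have dq: "(q has_real_derivative m * R * cos \<tau> / (2 * q \<tau>)) (at \<tau>)" for \<tau>
      using pos[of \<tau>] unfolding q_def by (auto intro!: derivative_eq_intros simp: field_simps)
    let ?X = "\<lambda>\<tau>. e * q \<tau>" and ?Y = "\<lambda>\<tau>. e * (R * cos \<tau>)"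
    have "periodic_orbit (newton_field ?f) (range (\<lambda>\<tau>. vector [?X \<tau>, ?Y \<tau>]))"
    proof (rule periodic_orbit_curve[where G="\<lambda>\<tau>. \<beta> * m * q \<tau>" and L="2 * pi"
          and M="\<beta> * m * sqrt (k + m * R)"
          and X'="\<lambda>\<tau>. e * (m * R * cos \<tau> / (2 * q \<tau>))" and Y'="\<lambda>\<tau>. e * (- R * sin \<tau>)"
          and s=0 and t="pi / 2"])
      show "continuous_on UNIV (\<lambda>\<tau>. \<beta> * m * q \<tau>)"
        unfolding q_def by (intro continuous_intros)
      show "\<beta> * m * q \<tau> \<le> \<beta> * m * sqrt (k + m * R)" for \<tau>
      proof -
        have "m * R * sin \<tau> \<le> m * R * 1"
          using m R by (intro mult_left_mono) auto
        then show ?thesis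
          unfolding q_def using m \<open>\<beta> > 0\<close> by (intro mult_left_mono) auto
      qed
      show "newton_field ?f (vector [?X \<tau>, ?Y \<tau>]) = vector
          [\<beta> * m * q \<tau> * (e * (m * R * cos \<tau> / (2 * q \<tau>))), \<beta> * m * q \<tau> * (e * (- R * sin \<tau>))]" for \<tau>
      proof -
        have "\<beta> * m * q \<tau> * (e * (m * R * cos \<tau> / (2 * q \<tau>))) = (\<beta> * m * m) * (e * (R * cos \<tau>)) / 2"
          using q_pos[of \<tau>] by simp
        moreover have "?f (e * q \<tau>) = e * (- \<beta> * q \<tau> * ((q \<tau>)\<^sup>2 - k))"
          using e by (auto simp: power2_eq_square power3_eq_cube algebra_simps)
        then have "?f (e * q \<tau>) = \<beta> * m * q \<tau> * (e * (- R * sin \<tau>))"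
          unfolding q_sq by simp
        ultimately show ?thesis by (simp add: vec2_eq_iff m3)
      qed
      show "?X 0 \<noteq> ?X (pi / 2)" using e m R by (auto simp: q_def)
      show "\<beta> * m * q (\<tau> + 2 * pi) = \<beta> * m * q \<tau>" "?X (\<tau> + 2 * pi) = ?X \<tau>" for \<tau>
        by (simp_all add: q_def)
      show "(?X has_real_derivative e * (m * R * cos \<tau> / (2 * q \<tau>))) (at \<tau>)" for \<tau>
        by (rule DERIV_cmult[OF dq])
    qed (use q_pos m \<open>\<beta> > 0\<close> in \<open>auto intro!: derivative_eq_intros\<close>)
    moreover have "range (\<lambda>\<tau>. vector [?X \<tau>, ?Y \<tau>] :: real^2) = {w \<in> U. H w = H z}"
    proof (intro equalityI subsetI)
      fix w :: "real^2" assume "w \<in> range (\<lambda>\<tau>. vector [?X \<tau>, ?Y \<tau>])"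
      then obtain \<tau> where \<tau>: "w = vector [?X \<tau>, ?Y \<tau>]" by blast
      have "H w = R\<^sup>2 * (cos \<tau>)\<^sup>2 / 2 + (\<beta> * m\<^sup>2) * (R\<^sup>2 * (sin \<tau>)\<^sup>2) / 4"
        by (simp add: \<tau> H_def power_mult_distrib ee q_sq)
      also have "\<dots> = R\<^sup>2 / 2" unfolding m(2) cos_squared_eq by (simp add: field_simps)
      finally have "H w = H z" by (simp add: R(2))
      moreover have "0 < e * w $ 1" using q_pos[of \<tau>] by (simp add: \<tau> ee)
      ultimately show "w \<in> {w \<in> U. H w = H z}" using Hk by (simp add: U_def)
    next
      fix w :: "real^2" assume w: "w \<in> {w \<in> U. H w = H z}"
      define x y where "x = e * w $ 2 / R" and "y = ((w $ 1)\<^sup>2 - k) / (m * R)"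
      have wx: "w $ 2 = e * (R * x)" using R by (simp add: x_def ee)
      have wy: "(w $ 1)\<^sup>2 = k + m * R * y" using R m by (simp add: y_def)
      have "2 * H w = R\<^sup>2 * x\<^sup>2 + (\<beta> * m\<^sup>2) * (R\<^sup>2 * y\<^sup>2) / 2"
        by (simp add: H_def wx wy power_mult_distrib ee)
      then have "R\<^sup>2 * (x\<^sup>2 + y\<^sup>2) = R\<^sup>2 * 1"
        using w R(2) unfolding m(2) by (simp add: distrib_left)
      then have "x\<^sup>2 + y\<^sup>2 = 1" using R(1) by (simp only: mult_cancel_left) simp
      then obtain \<tau> where \<tau>: "x = cos \<tau>" "y = sin \<tau>" using sincos_total_2pi by metis
      have "e * w $ 1 = q \<tau>"
        unfolding q_def \<tau>(2)[symmetric] wy[symmetric]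
        using w ee by (intro real_sqrt_unique[symmetric]) (auto simp: U_def power_mult_distrib)
      then have "w $ 1 = e * q \<tau>" using ee(3)[of "w $ 1"] by simp
      then have "w = vector [?X \<tau>, ?Y \<tau>]" using wx \<tau> by (simp add: vec2_eq_iff)
      then show "w \<in> range (\<lambda>\<tau>. vector [?X \<tau>, ?Y \<tau>])" by blast
    qed
    ultimately show "periodic_orbit (newton_field ?f) {w \<in> U. H w = H z}" by simp
  qed
qed

section \<open>The cubic field\<close>

text \<open>The expression in the hypothesis is the cofactor of \<open>x - p\<^sub>0\<close> in the
  cubic. Its sign gives the sign condition and its bound on the interval the constant L. It may
  vanish at \<open>p\<^sub>0\<close>, as it does in the degenerate case.\<close>

lemma cubic_saddle:
  fixes \<alpha> \<beta> p\<^sub>0 \<delta> :: real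
  assumes "0 < \<delta>" and zero: "\<alpha> * p\<^sub>0 - \<beta> * p\<^sub>0 ^ 3 = 0"
    and pos: "\<And>x. x \<in> {p\<^sub>0 - \<delta>..p\<^sub>0 + \<delta>} \<Longrightarrow> x \<noteq> p\<^sub>0 \<Longrightarrow> 0 < \<alpha> - \<beta> * (x\<^sup>2 + x * p\<^sub>0 + p\<^sub>0\<^sup>2)"
  shows "is_saddle (newton_field (\<lambda>p. \<alpha> * p - \<beta> * p ^ 3)) (vector [p\<^sub>0, 0])"
proof -
  define h where "h x = \<alpha> - \<beta> * (x\<^sup>2 + x * p\<^sub>0 + p\<^sub>0\<^sup>2)" for x
  have f: "\<alpha> * x - \<beta> * x ^ 3 = (x - p\<^sub>0) * h x" for x
  proof -
    have "\<alpha> * x - \<beta> * x ^ 3 - (\<alpha> * p\<^sub>0 - \<beta> * p\<^sub>0 ^ 3) = (x - p\<^sub>0) * h x"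
      by (simp add: h_def algebra_simps power2_eq_square power3_eq_cube)
    then show ?thesis by (simp add: zero)
  qed
  have "bounded (h ` {p\<^sub>0 - \<delta>..p\<^sub>0 + \<delta>})"
    unfolding h_def
    by (intro compact_imp_bounded compact_continuous_image continuous_intros) simp
  then obtain L where L: "\<And>x. x \<in> {p\<^sub>0 - \<delta>..p\<^sub>0 + \<delta>} \<Longrightarrow> \<bar>h x\<bar> \<le> L"
    unfolding bounded_iff by (metis image_eqI real_norm_def)
  interpret saddle_potential "\<lambda>p. \<alpha> * p - \<beta> * p ^ 3"
    "\<lambda>p. \<alpha> * p\<^sup>2 / 2 - \<beta> * p ^ 4 / 4 - (\<alpha> * p\<^sub>0\<^sup>2 / 2 - \<beta> * p\<^sub>0 ^ 4 / 4)" p\<^sub>0 \<delta> L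
  proof
    fix x assume x: "x \<in> {p\<^sub>0 - \<delta>..p\<^sub>0 + \<delta>}"
    show "((\<lambda>p. \<alpha> * p\<^sup>2 / 2 - \<beta> * p ^ 4 / 4 - (\<alpha> * p\<^sub>0\<^sup>2 / 2 - \<beta> * p\<^sub>0 ^ 4 / 4))
        has_real_derivative \<alpha> * x - \<beta> * x ^ 3) (at x)"
      by (auto intro!: derivative_eq_intros)
    show "0 < (x - p\<^sub>0) * (\<alpha> * x - \<beta> * x ^ 3)" if "x \<noteq> p\<^sub>0"
    proof -
      have "0 < (x - p\<^sub>0)\<^sup>2 * h x" using pos[OF x that] that by (simp add: h_def)
      then show ?thesis by (simp add: f power2_eq_square mult.assoc)
    qed
    show "\<bar>\<alpha> * x - \<beta> * x ^ 3\<bar> \<le> L * \<bar>x - p\<^sub>0\<bar>"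
      unfolding f abs_mult using mult_right_mono[OF L[OF x], of "\<bar>x - p\<^sub>0\<bar>"]
      by (simp add: mult.commute)
  qed (use \<open>0 < \<delta>\<close> in \<open>auto intro!: continuous_intros\<close>)
  show ?thesis by (rule saddle)
qed

text \<open>At \<open>p\<^sub>0\<close> the cofactor equals the derivative of the cubic, so by
  continuity it stays positive nearby.\<close>

lemma cubic_saddle_nondegenerate:
  fixes \<alpha> \<beta> p\<^sub>0 :: real
  assumes "\<alpha> * p\<^sub>0 - \<beta> * p\<^sub>0 ^ 3 = 0" and pos: "0 < \<alpha> - 3 * \<beta> * p\<^sub>0\<^sup>2"
  shows "is_saddle (newton_field (\<lambda>p. \<alpha> * p - \<beta> * p ^ 3)) (vector [p\<^sub>0, 0])"
proof -
  let ?h = "\<lambda>x. \<alpha> - \<beta> * (x\<^sup>2 + x * p\<^sub>0 + p\<^sub>0\<^sup>2)"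
  have "isCont ?h p\<^sub>0" by (intro continuous_intros)
  moreover have "0 < ?h p\<^sub>0" using pos by (simp add: power2_eq_square algebra_simps)
  ultimately have "\<forall>\<^sub>F x in at p\<^sub>0. 0 < ?h x"
    unfolding isCont_def by (rule order_tendstoD(1))
  then obtain d where d: "0 < d" "\<And>x. x \<noteq> p\<^sub>0 \<Longrightarrow> dist x p\<^sub>0 < d \<Longrightarrow> 0 < ?h x"
    unfolding eventually_at by auto
  show ?thesis
    by (rule cubic_saddle[of "d / 2"]) (use assms(1) d in \<open>auto simp: dist_real_def abs_less_iff\<close>)
qed

section \<open>Jacobian and equilibria\<close>

lemma newton_field_derivative:
  assumes "(f has_real_derivative f') (at (z $ 1))"
  shows "(newton_field f has_derivative (\<lambda>h. vector [h $ 2, f' * h $ 1])) (at z)"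
proof -
  have "((\<lambda>z. f (z $ 1)) has_derivative (\<lambda>h. f' * h $ 1)) (at z)"
    by (rule has_derivative_compose[where g=f and f="\<lambda>z. z $ 1", OF _ assms[unfolded has_field_derivative_def]])
       (rule bounded_linear_imp_has_derivative[OF bounded_linear_vec_nth])
  then show ?thesis
    by (subst has_derivative_componentwise_within)
       (auto simp: Basis_vec_def inner_axis forall_2
         intro: bounded_linear_imp_has_derivative[OF bounded_linear_vec_nth])
qed

text \<open>The matrix has rows (0, 1) and (f', 0), hence determinant -f'.\<close>

lemma newton_field_jacobian:
  assumes "(f has_real_derivative f') (at (z $ 1))"
  shows "newton_field f differentiable (at z)" "invertible (jacobian (newton_field f) (at z)) \<longleftrightarrow> f' \<noteq> 0"
proof -
  note d = newton_field_derivative[OF assms]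
  show "newton_field f differentiable (at z)" using d by (auto simp: differentiable_def)
  have "jacobian (newton_field f) (at z) = matrix (\<lambda>h. vector [h $ 2, f' * h $ 1])"
    unfolding jacobian_def using frechet_derivative_at[OF d] by simp
  then show "invertible (jacobian (newton_field f) (at z)) \<longleftrightarrow> f' \<noteq> 0"
    by (simp add: invertible_det_nz det_2 matrix_def axis_def)
qed

lemma wave_field_eq_newton_field:
  "wave_field a b m \<kappa> \<omega> r =
    newton_field (\<lambda>p. (a * \<kappa> * \<omega> - r) / (a * m) * p - 2 * \<kappa> * b / (a * m) * p ^ 3)"
  by (simp add: fun_eq_iff wave_field_def newton_field_def)

lemma cubic_equilibria:
  fixes \<alpha> \<beta> :: real
  assumes "\<beta> \<noteq> 0"
  shows "{x. equilibrium (newton_field (\<lambda>p. \<alpha> * p - \<beta> * p ^ 3)) x} =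
    (if 0 < \<alpha> / \<beta> then {vector [- sqrt (\<alpha> / \<beta>), 0], vector [0, 0], vector [sqrt (\<alpha> / \<beta>), 0]}
     else {vector [0, 0]})"
proof -
  have root: "\<alpha> * p = \<beta> * p ^ 3 \<longleftrightarrow> p = 0 \<or> p\<^sup>2 = \<alpha> / \<beta>" for p
  proof -
    have "\<alpha> * p - \<beta> * p ^ 3 = \<beta> * (p * (\<alpha> / \<beta> - p\<^sup>2))"
      using assms by (simp add: field_simps power2_eq_square power3_eq_cube)
    then have "\<alpha> * p = \<beta> * p ^ 3 \<longleftrightarrow> p * (\<alpha> / \<beta> - p\<^sup>2) = 0"
      using assms by (metis eq_iff_diff_eq_0 mult_eq_0_iff)
    then show ?thesis by auto
  qed
  have sq: "p\<^sup>2 = k \<longleftrightarrow> p = - sqrt k \<or> p = sqrt k" if "0 < k" for p k :: real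
    using that by (metis less_le_not_le power2_eq_iff real_sqrt_pow2)
  show ?thesis
  proof (cases "0 < \<alpha> / \<beta>")
    case True
    then show ?thesis
      by (auto simp: equilibrium_def vec2_eq_iff root sq[OF True])
  next
    case False
    then have "p\<^sup>2 = \<alpha> / \<beta> \<Longrightarrow> p = 0" for p
      by (metis not_less zero_less_power2)
    then show ?thesis using False by (auto simp: equilibrium_def vec2_eq_iff root)
  qed
qed

theorem theorem1:
  fixes a b m \<kappa> \<omega> r :: real
    and F :: "real^2 \<Rightarrow> real^2" and P\<^sub>1 P\<^sub>2 P\<^sub>3 :: "real^2"
  assumes "a * m \<noteq> 0" and "\<kappa> * b \<noteq> 0"
  defines "F \<equiv> wave_field a b m \<kappa> \<omega> r"
    and "P\<^sub>1 \<equiv> vector [- sqrt ((a * \<kappa> * \<omega> - r) / (2 * \<kappa> * b)), 0]"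
    and "P\<^sub>2 \<equiv> vector [0, 0]"
    and "P\<^sub>3 \<equiv> vector [sqrt ((a * \<kappa> * \<omega> - r) / (2 * \<kappa> * b)), 0]"
  shows
    "(\<kappa> * b * (a * \<kappa> * \<omega> - r) > 0 \<longrightarrow>
        {x. equilibrium F x} = {P\<^sub>1, P\<^sub>2, P\<^sub>3} \<and> card {P\<^sub>1, P\<^sub>2, P\<^sub>3} = 3 \<and>
        (\<kappa> * b / (a * m) < 0 \<longrightarrow> is_saddle F P\<^sub>1 \<and> is_saddle F P\<^sub>3 \<and> is_center F P\<^sub>2) \<and>
        (\<kappa> * b / (a * m) > 0 \<longrightarrow> is_center F P\<^sub>1 \<and> is_center F P\<^sub>3 \<and> is_saddle F P\<^sub>2)) \<and>
     (\<kappa> * b * (a * \<kappa> * \<omega> - r) < 0 \<longrightarrow>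
        {x. equilibrium F x} = {P\<^sub>2} \<and> simple_equilibrium F P\<^sub>2 \<and>
        (\<kappa> * b / (a * m) < 0 \<longrightarrow> is_saddle F P\<^sub>2) \<and>
        (\<kappa> * b / (a * m) > 0 \<longrightarrow> is_center F P\<^sub>2)) \<and>
     (a * \<kappa> * \<omega> - r = 0 \<longrightarrow>
        {x. equilibrium F x} = {P\<^sub>2} \<and> degenerate_equilibrium F P\<^sub>2 \<and>
        (\<kappa> * b / (a * m) < 0 \<longrightarrow> is_saddle F P\<^sub>2) \<and>
        (\<kappa> * b / (a * m) > 0 \<longrightarrow> is_center F P\<^sub>2))"
proof -
  define \<alpha> \<beta> n k where "\<alpha> = (a * \<kappa> * \<omega> - r) / (a * m)" and "\<beta> = 2 * \<kappa> * b / (a * m)"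
    and "n = a * \<kappa> * \<omega> - r" and "k = (a * \<kappa> * \<omega> - r) / (2 * \<kappa> * b)"
  note defs = this
  have F: "F = newton_field (\<lambda>p. \<alpha> * p - \<beta> * p ^ 3)"
    by (simp add: F_def wave_field_eq_newton_field defs)
  have \<beta>: "\<beta> \<noteq> 0" and k: "\<alpha> / \<beta> = k" "\<alpha> = \<beta> * k"
    using assms(1,2) by (auto simp: defs)
  have \<beta>_sign: "\<kappa> * b / (a * m) < 0 \<longleftrightarrow> \<beta> < 0" "\<kappa> * b / (a * m) > 0 \<longleftrightarrow> \<beta> > 0"
    by (auto simp: \<beta>_def field_simps divide_less_0_iff zero_less_divide_iff)
  have k_sign: "\<kappa> * b * n > 0 \<longleftrightarrow> k > 0" "\<kappa> * b * n < 0 \<longleftrightarrow> k < 0" "n = 0 \<longleftrightarrow> k = 0"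
    using assms(2)
    by (auto simp: defs zero_less_mult_iff mult_less_0_iff zero_less_divide_iff divide_less_0_iff)
  have P: "P\<^sub>1 = vector [- 1 * sqrt k, 0]" "P\<^sub>2 = vector [0, 0]" "P\<^sub>3 = vector [1 * sqrt k, 0]"
    by (simp_all add: P\<^sub>1_def P\<^sub>2_def P\<^sub>3_def k_def)
  note eqs = cubic_equilibria[OF \<beta>, of \<alpha>, folded F, unfolded k(1)]
  have jac: "F differentiable (at P\<^sub>2)" "invertible (jacobian F (at P\<^sub>2)) \<longleftrightarrow> \<alpha> \<noteq> 0"
  proof -
    have "((\<lambda>p. \<alpha> * p - \<beta> * p ^ 3) has_real_derivative \<alpha>) (at (P\<^sub>2 $ 1))"
      by (auto simp: P intro!: derivative_eq_intros)
    then show "F differentiable (at P\<^sub>2)" "invertible (jacobian F (at P\<^sub>2)) \<longleftrightarrow> \<alpha> \<noteq> 0"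
      unfolding F by (rule newton_field_jacobian)+
  qed
  have eq2: "equilibrium F P\<^sub>2" by (simp add: F P equilibrium_def vec2_eq_iff)
  have saddle13: "is_saddle F P\<^sub>1" "is_saddle F P\<^sub>3" if "k > 0" "\<beta> < 0"
  proof -
    \<comment> \<open>At the outer equilibria p^2 = k, and the derivative of the cubic is -2 \<beta>
      k.\<close>
    have "\<alpha> - 3 * \<beta> * k > 0" using that by (simp add: k(2) mult_less_0_iff)
    then show "is_saddle F P\<^sub>1" "is_saddle F P\<^sub>3"
      unfolding F P using that
      by (intro cubic_saddle_nondegenerate; simp add: k(2) power3_eq_cube)+
  qed
  have center13: "is_center F P\<^sub>1" "is_center F P\<^sub>3" if "k > 0" "\<beta> > 0"
    unfolding F P k(2) using that by (intro cubic_center_nonzero; simp)+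
  \<comment> \<open>As \<alpha> = \<beta> k, this serves both k, \<beta> > 0 and k, \<beta> <
    0.\<close>
  have saddle2: "is_saddle F P\<^sub>2" if "\<alpha> > 0"
    unfolding F P using that by (intro cubic_saddle_nondegenerate) auto
  \<comment> \<open>The derivative test fails here, but the cofactor is -\<beta> x^2, positive for
    all x other than 0; the radius 1 is arbitrary.\<close>
  have saddle2': "is_saddle F P\<^sub>2" if "\<alpha> = 0" "\<beta> < 0"
    unfolding F P by (rule cubic_saddle[of 1]) (use that in \<open>auto simp: mult_less_0_iff\<close>)
  have center2: "is_center F P\<^sub>2" if "k > 0" "\<beta> < 0"
    unfolding F P
  \<comment> \<open>The region extends up to the two saddles.\<close>
  proof (rule cubic_center_zero[of "sqrt k"])
    fix p :: real assume "0 < p" "p < sqrt k"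
    then have "p\<^sup>2 < (sqrt k)\<^sup>2" by (intro power_strict_mono) auto
    then have "\<beta> * k < \<beta> * p\<^sup>2" using that by simp
    then show "0 < - \<alpha> + \<beta> * p\<^sup>2" by (simp add: k(2))
  qed (use that in simp)
  have center2': "is_center F P\<^sub>2" if "k \<le> 0" "\<beta> > 0"
    unfolding F P
  \<comment> \<open>For k <= 0 the force is restoring at every p > 0, so any radius would do; k = 0
    is the degenerate center.\<close>
  proof (rule cubic_center_zero[of 1])
    fix p :: real assume "0 < p" "p < 1"
    then have "k < p\<^sup>2" using that zero_less_power[of p 2] by linarith
    then have "0 < \<beta> * (p\<^sup>2 - k)" using that by simp
    then show "0 < - \<alpha> + \<beta> * p\<^sup>2" by (simp add: k(2) right_diff_distrib)
  qed simp
  have "card {P\<^sub>1, P\<^sub>2, P\<^sub>3} = 3" if "k > 0"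
    using that by (simp add: P vec2_eq_iff)
  then show ?thesis
    unfolding n_def[symmetric] \<beta>_sign k_sign
    using eqs eq2 jac saddle13 center13 saddle2 saddle2' center2 center2'
    by (auto simp: P k(2) \<beta> simple_equilibrium_def degenerate_equilibrium_def mult_neg_neg)
qed

end
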